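(* There exist absolute constants $c,C>0$ such that for any (positive definite) covariance matrix $\Sigma\in\mathbb{R}^{p\times p}$ the following holds. For every $\theta\in\mathbb{R}^p$ and $\delta\in(0,1)$, with probability at least $1-\delta-e^{-cn}$ (over the training data), $$\mathcal{R}(\hat\eta_{\mathrm{ave}})\ \le\ C\exp\left(-c\,\frac{\|\theta\|^4}{\theta^\top\Sigma\theta+\frac{\operatorname{Tr}(\Sigma^2)+\|\Sigma\|_\infty^2\log(1/\delta)}{n}}\right).$$ Moreover, for every $\Delta>0$, $$\sup_{\|\theta\|^2\ge\Delta^2\|\Sigma\|_\infty}\mathbf{E}\big(\mathcal{R}(\hat\eta_{\mathrm{ave}})\big)\ \le\ C\exp\left(-c\,\frac{\Delta^4}{\Delta^2+\frac{r(\Sigma^2)}{n}}\right).$$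
   Context: Model (Gaussian noise). $n,p\ge1$ are integers. One observes pairs $(Y_i,\eta_i)$, $i=1,\dots,n$, with $Y_i=\theta\eta_i+W_i\in\mathbb{R}^p$, where $\theta\in\mathbb{R}^p$, $\eta=(\eta_1,\dots,\eta_n)^\top\in\{-1,1\}^n$ is a label vector not depending on the noise, and $W_1,\dots,W_n$ are i.i.d. $\mathcal{N}(0,\Sigma)$ with $\Sigma$ of full rank. Write $(\mathbf{Y},\eta)$ for the training data. A new observation $(Y_{n+1},\eta_{n+1})$, independent of the training data, satisfies $Y_{n+1}=\theta\eta_{n+1}+W_{n+1}$, with $\eta_{n+1}$ uniform on $\{-1,1\}$ and independent of $W_{n+1}\sim\mathcal{N}(0,\Sigma)$. The generalization error of a classifier $\hat\eta$ is the random variable $\mathcal{R}(\hat\eta)=\mathcal{R}_\Sigma(\hat\eta)=\mathbb{P}\big(\hat\eta((\mathbf{Y},\eta);Y_{n+1})\ne\eta_{n+1}\mid(\mathbf{Y},\eta)\big)$. The averaging classifier is $\hat\eta_{\mathrm{ave}}(y)=\operatorname{sign}\big(\big\langle\sum_{i=1}^nY_i\eta_i,\,y\big\rangle\big)$. Notation: $\|\theta\|$ is the Euclidean norm; for a positive semidefinite nonzero matrix $A$, $\|A\|_\infty$ is its largest eigenvalue and $r(A)=\operatorname{Tr}(A)/\|A\|_\infty$. *)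

theory Defs
  imports "HOL-Probability.Probability" "Jordan_Normal_Form.Spectral_Radius"
begin

unbundle no vec_syntax
unbundle no inner_syntax

(* The dimension p is an ordinary natural number, not a type: the constants of the theorem must
   not depend on it, so it has to be quantified after them.  Vectors of R^p are the elements of
   carrier_vec p, with indices 0,...,p-1. *)

section \<open>Linear algebra\<close>

definition eucl_norm :: "real vec \<Rightarrow> real" where
  "eucl_norm v = sqrt (v \<bullet> v)"

definition quad_form :: "real mat \<Rightarrow> real vec \<Rightarrow> real" where
  "quad_form A v = v \<bullet> (A *\<^sub>v v)"

definition mat_trace :: "real mat \<Rightarrow> real" where
  "mat_trace A = (\<Sum>i<dim_row A. A $$ (i, i))"

definition pos_def_mat :: "nat \<Rightarrow> real mat \<Rightarrow> bool" where
  "pos_def_mat p A \<longleftrightarrow> A \<in> carrier_mat p p \<and> transpose_mat A = A \<and>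
     (\<forall>v \<in> carrier_vec p. v \<noteq> 0\<^sub>v p \<longrightarrow> quad_form A v > 0)"

definition largest_eigenvalue :: "real mat \<Rightarrow> real" where
  "largest_eigenvalue A = Max (spectrum A)"

definition effective_rank :: "real mat \<Rightarrow> real" where
  "effective_rank A = mat_trace A / largest_eigenvalue A"

section \<open>Gaussian vectors\<close>

definition borel_vec :: "nat \<Rightarrow> real vec measure" where
  "borel_vec p = vimage_algebra (carrier_vec p) (\<lambda>v. \<lambda>i\<in>{..<p}. v $ i)
     (Pi\<^sub>M {..<p} (\<lambda>_. borel :: real measure))"

(* N is the law N(0, S), S positive definite: every linear functional u of the vector is a
   centred normal variable with variance u^T S u.  The functional u = 0 is excluded because
   normal_density has no meaning for standard deviation 0; it carries no information. *)
definition gaussian_law :: "nat \<Rightarrow> real mat \<Rightarrow> real vec measure \<Rightarrow> bool" where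
  "gaussian_law p S N \<longleftrightarrow> prob_space N \<and> sets N = sets (borel_vec p) \<and>
     (\<forall>u \<in> carrier_vec p. u \<noteq> 0\<^sub>v p \<longrightarrow>
        distributed N lborel (\<lambda>w. u \<bullet> w) (normal_density 0 (sqrt (quad_form S u))))"

(* Satisfiability of gaussian_law for S = B B^T, B invertible: the law of B z, z standard normal. *)
lemma gaussian_law_image:
  assumes B: "B \<in> carrier_mat p p"
    and inv: "\<And>u. u \<in> carrier_vec p \<Longrightarrow> u \<noteq> 0\<^sub>v p \<Longrightarrow> transpose_mat B *\<^sub>v u \<noteq> 0\<^sub>v p"
  shows "gaussian_law p (B * transpose_mat B)
    (distr (Pi\<^sub>M {..<p} (\<lambda>_. density lborel std_normal_density)) (borel_vec p) (\<lambda>z. B *\<^sub>v vec p z))"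
proof -
  let ?G = "density lborel std_normal_density"
  let ?M = "Pi\<^sub>M {..<p} (\<lambda>_. ?G)"
  let ?T = "\<lambda>z. B *\<^sub>v vec p z"
  interpret G: prob_space ?G by (rule prob_space_normal_density) simp
  interpret P: product_prob_space "\<lambda>_. ?G" "{..<p}" by standard
  have comp: "(\<lambda>z. z i) \<in> borel_measurable ?M" if "i < p" for i
    using measurable_component_singleton[of i "{..<p}" "\<lambda>_. ?G"] that by simp
  have T: "?T \<in> measurable ?M (borel_vec p)"
    unfolding borel_vec_def
  proof (rule measurable_vimage_algebra2)
    show "?T \<in> space ?M \<rightarrow> carrier_vec p" using B by auto
    have "(\<lambda>z. \<Sum>j<p. B $$ (i, j) * z j) \<in> borel_measurable ?M" if "i < p" for i
      using comp by (intro borel_measurable_sum borel_measurable_times) auto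
    moreover have "?T z $ i = (\<Sum>j<p. B $$ (i, j) * z j)" if "i < p" for z i
      using that B by (auto simp: scalar_prod_def atLeast0LessThan intro!: sum.cong)
    ultimately show "(\<lambda>z. \<lambda>i\<in>{..<p}. ?T z $ i) \<in> measurable ?M (Pi\<^sub>M {..<p} (\<lambda>_. borel))"
      by (intro measurable_restrict) simp
  qed
  have ind: "P.indep_vars (\<lambda>_. borel) (\<lambda>i z. z i) {..<p}" if "p > 0"
  proof (subst P.indep_vars_iff_distr_eq_PiM')
    show "{..<p} \<noteq> {}" using that by auto
    have "distr ?M (Pi\<^sub>M {..<p} (\<lambda>_. borel)) (\<lambda>x. \<lambda>i\<in>{..<p}. x i) = distr ?M ?M (\<lambda>x. x)"
      by (intro distr_cong sets_PiM_cong) (auto simp: space_PiM PiE_restrict)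
    also have "\<dots> = Pi\<^sub>M {..<p} (\<lambda>i. distr ?M borel (\<lambda>z. z i))"
    proof (subst distr_id, intro PiM_cong refl)
      fix i assume "i \<in> {..<p}"
      then have "distr ?M ?G (\<lambda>z. z i) = ?G" by (intro distr_PiM_component G.prob_space_axioms) auto
      moreover have "distr ?M ?G (\<lambda>z. z i) = distr ?M borel (\<lambda>z. z i)" by (intro distr_cong) auto
      ultimately show "?G = distr ?M borel (\<lambda>z. z i)" by simp
    qed
    finally show "distr ?M (Pi\<^sub>M {..<p} (\<lambda>_. borel)) (\<lambda>x. \<lambda>i\<in>{..<p}. x i) =
      Pi\<^sub>M {..<p} (\<lambda>i. distr ?M borel (\<lambda>z. z i))" .
  qed (use comp in auto)
  have std: "distributed ?M lborel (\<lambda>z. z i) std_normal_density" if "i < p" for i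
  proof -
    have "distr ?M ?G (\<lambda>z. z i) = ?G" using that by (intro distr_PiM_component G.prob_space_axioms) auto
    moreover have "distr ?M ?G (\<lambda>z. z i) = distr ?M lborel (\<lambda>z. z i)" by (intro distr_cong) auto
    ultimately show ?thesis using comp[OF that] by (auto simp: distributed_def)
  qed
  have lin: "distributed ?M lborel (\<lambda>z. u \<bullet> ?T z)
      (normal_density 0 (sqrt (quad_form (B * transpose_mat B) u)))"
    if u: "u \<in> carrier_vec p" "u \<noteq> 0\<^sub>v p" for u
  proof -
    define a where "a = transpose_mat B *\<^sub>v u"
    have a: "a \<in> carrier_vec p" "a \<noteq> 0\<^sub>v p" using B u inv by (auto simp: a_def)
    define I where "I = {i. i < p \<and> a $ i \<noteq> 0}"
    have I: "finite I" "I \<noteq> {}" "I \<subseteq> {..<p}" using a by (auto simp: I_def)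
    then have p: "p > 0" by auto
    have "P.indep_vars (\<lambda>_. borel) (\<lambda>i z. a $ i * z i) I"
      using P.indep_vars_compose2[OF P.indep_vars_subset[OF ind[OF p] I(3)], of "\<lambda>i x. a $ i * x" "\<lambda>_. borel"]
      by simp
    moreover have "distributed ?M lborel (\<lambda>z. a $ i * z i) (normal_density 0 \<bar>a $ i\<bar>)" if "i \<in> I" for i
      using P.normal_density_affine[OF std, of i "a $ i" 0] that I by (auto simp: I_def)
    ultimately have *: "distributed ?M lborel (\<lambda>z. \<Sum>i\<in>I. a $ i * z i)
        (normal_density (\<Sum>i\<in>I. 0) (sqrt (\<Sum>i\<in>I. \<bar>a $ i\<bar>\<^sup>2)))"
      using I by (intro P.sum_indep_normal) (auto simp: I_def)
    have "u \<bullet> ?T z = (\<Sum>i\<in>I. a $ i * z i)" for z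
    proof -
      have "u \<bullet> ?T z = a \<bullet> vec p z"
        unfolding a_def using transpose_vec_mult_scalar[OF B vec_carrier u(1), of z] by simp
      also have "\<dots> = (\<Sum>i<p. a $ i * z i)" by (simp add: scalar_prod_def atLeast0LessThan)
      also have "\<dots> = (\<Sum>i\<in>I. a $ i * z i)"
        by (intro sum.mono_neutral_right) (auto simp: I_def)
      finally show ?thesis .
    qed
    moreover have "quad_form (B * transpose_mat B) u = (\<Sum>i\<in>I. \<bar>a $ i\<bar>\<^sup>2)"
    proof -
      have "quad_form (B * transpose_mat B) u = u \<bullet> (B *\<^sub>v a)"
        using B u by (simp add: quad_form_def a_def assoc_mult_mat_vec[of _ p p _ p])
      also have "\<dots> = a \<bullet> a"
        unfolding a_def using transpose_vec_mult_scalar[OF B _ u(1), of "transpose_mat B *\<^sub>v u"] B u by simp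
      also have "\<dots> = (\<Sum>i<p. \<bar>a $ i\<bar>\<^sup>2)"
        using a by (simp add: scalar_prod_def atLeast0LessThan power2_eq_square)
      also have "\<dots> = (\<Sum>i\<in>I. \<bar>a $ i\<bar>\<^sup>2)"
        by (intro sum.mono_neutral_right) (auto simp: I_def)
      finally show ?thesis .
    qed
    ultimately show ?thesis using * by simp
  qed
  have meas: "(\<lambda>w. u \<bullet> w) \<in> borel_measurable (borel_vec p)" for u
  proof -
    have c: "(\<lambda>w. w $ i) \<in> borel_measurable (borel_vec p)" if "i < p" for i
    proof -
      have "(\<lambda>v. \<lambda>i\<in>{..<p}. v $ i) \<in> measurable (borel_vec p) (Pi\<^sub>M {..<p} (\<lambda>_. borel))"
        unfolding borel_vec_def by (rule measurable_vimage_algebra1) (auto simp: space_PiM)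
      from measurable_compose[OF this measurable_component_singleton[of i]] that show ?thesis by simp
    qed
    have "(\<lambda>w. \<Sum>i<p. u $ i * w $ i) \<in> borel_measurable (borel_vec p)"
      using c by (intro borel_measurable_sum borel_measurable_times) auto
    then show ?thesis
      by (rule measurable_cong[THEN iffD1, rotated])
         (auto simp: borel_vec_def scalar_prod_def atLeast0LessThan)
  qed
  show ?thesis unfolding gaussian_law_def
  proof (intro conjI ballI impI)
    show "prob_space (distr ?M (borel_vec p) ?T)" by (rule P.prob_space_distr[OF T])
    show "sets (distr ?M (borel_vec p) ?T) = sets (borel_vec p)" by simp
    fix u :: "real vec" assume "u \<in> carrier_vec p" "u \<noteq> 0\<^sub>v p"
    from lin[OF this] show "distributed (distr ?M (borel_vec p) ?T) lborel (\<lambda>w. u \<bullet> w)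
      (normal_density 0 (sqrt (quad_form (B * transpose_mat B) u)))"
      using distr_distr[of "\<lambda>w. u \<bullet> w" "borel_vec p" lborel ?T ?M] T meas[of u]
      by (simp add: distributed_def comp_def)
  qed
qed

section \<open>The model\<close>

definition label_vectors :: "nat \<Rightarrow> real vec set" where
  "label_vectors n = {\<eta> \<in> carrier_vec n. \<forall>i<n. \<eta> $ i \<in> {-1, 1}}"

(* An outcome is ((\<eta>, W), (e, w)): training labels and training noise, new label and new noise.
   All components are independent.  Q is the law of the label vector; a nonrandom \<eta> is the
   case Q = return_pmf \<eta>. *)
type_synonym outcome = "(real vec \<times> (nat \<Rightarrow> real vec)) \<times> (real \<times> real vec)"

definition model :: "nat \<Rightarrow> real vec pmf \<Rightarrow> real vec measure \<Rightarrow> outcome measure" where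
  "model n Q N =
     (measure_pmf Q \<Otimes>\<^sub>M Pi\<^sub>M {..<n} (\<lambda>_. N)) \<Otimes>\<^sub>M (measure_pmf (pmf_of_set {-1, 1}) \<Otimes>\<^sub>M N)"

type_synonym training_data = "(nat \<Rightarrow> real vec) \<times> real vec"

fun training_data :: "nat \<Rightarrow> real vec \<Rightarrow> outcome \<Rightarrow> training_data" where
  "training_data n \<theta> ((\<eta>, W), (e, w)) = ((\<lambda>i\<in>{..<n}. (\<eta> $ i) \<cdot>\<^sub>v \<theta> + W i), \<eta>)"

fun new_label :: "outcome \<Rightarrow> real" where
  "new_label ((\<eta>, W), (e, w)) = e"

fun new_observation :: "real vec \<Rightarrow> outcome \<Rightarrow> real vec" where
  "new_observation \<theta> ((\<eta>, W), (e, w)) = e \<cdot>\<^sub>v \<theta> + w"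

definition training_space :: "nat \<Rightarrow> nat \<Rightarrow> training_data measure" where
  "training_space n p = Pi\<^sub>M {..<n} (\<lambda>_. borel_vec p) \<Otimes>\<^sub>M count_space UNIV"

definition training_algebra ::
  "nat \<Rightarrow> nat \<Rightarrow> real vec pmf \<Rightarrow> real vec measure \<Rightarrow> real vec \<Rightarrow> outcome measure" where
  "training_algebra n p Q N \<theta> =
     vimage_algebra (space (model n Q N)) (training_data n \<theta>) (training_space n p)"

section \<open>Classifiers\<close>

type_synonym classifier = "training_data \<Rightarrow> real vec \<Rightarrow> real"

definition generalization_error ::
  "nat \<Rightarrow> nat \<Rightarrow> real vec pmf \<Rightarrow> real vec measure \<Rightarrow> real vec \<Rightarrow> classifier \<Rightarrow> outcome \<Rightarrow> real" where
  "generalization_error n p Q N \<theta> h =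
     real_cond_exp (model n Q N) (training_algebra n p Q N \<theta>)
       (indicator {\<omega> \<in> space (model n Q N).
          h (training_data n \<theta> \<omega>) (new_observation \<theta> \<omega>) \<noteq> new_label \<omega>})"

(* sgn 0 = 0 is neither label, so a tie counts as an error. *)
fun averaging_classifier :: "nat \<Rightarrow> nat \<Rightarrow> classifier" where
  "averaging_classifier n p (Y, \<eta>) y = sgn (vec p (\<lambda>j. \<Sum>i<n. Y i $ j * \<eta> $ i) \<bullet> y)"

end

theory Submission
  imports Defs
begin

text \<open>
  Put \<open>S = \<Sum>i<n. \<eta>\<^sub>i W\<^sub>i\<close>. Because \<open>\<eta>\<^sub>i\<^sup>2 = 1\<close>, the averaging classifier is
  \<open>y \<mapsto> sgn (v \<bullet> y)\<close> with \<open>v = n \<theta> + S\<close>, and a new observation is misclassified exactly when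
  \<open>v \<bullet> (e w) \<le> - v \<bullet> \<theta>\<close>. For fixed \<open>v\<close> the variable \<open>v \<bullet> (e w)\<close> is centred normal with variance
  \<open>v\<^sup>T \<Sigma> v\<close>, so that a Chernoff bound gives the conditional error at most
  \<open>exp (- (v \<bullet> \<theta>)\<^sup>2 / (2 v\<^sup>T \<Sigma> v))\<close> as soon as \<open>v \<bullet> \<theta> > 0\<close> (lemma \<open>error_prob_le\<close>). Since the training
  data and the new pair are independent, Fubini identifies this probability with the conditional
  expectation that defines the generalization error (\<open>generalization_error_eq\<close>).

  It remains to control numerator and denominator through \<open>S\<close>. Outside an event of probability
  \<open>exp (- n \<parallel>\<theta>\<parallel>\<^sup>4 / (8 \<theta>\<^sup>T \<Sigma> \<theta>))\<close> one has \<open>v \<bullet> \<theta> \<ge> n \<parallel>\<theta>\<parallel>\<^sup>2 / 2\<close> (\<open>linear_tail\<close>), and outside an event of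
  probability \<open>exp (- L)\<close> one has \<open>S\<^sup>T \<Sigma> S \<le> n (2 Tr \<Sigma>\<^sup>2 + 4 \<parallel>\<Sigma>\<parallel>\<^sup>2 L)\<close> (\<open>quad_form_tail\<close>); together with
  \<open>v\<^sup>T \<Sigma> v \<le> 2 n\<^sup>2 \<theta>\<^sup>T \<Sigma> \<theta> + 2 S\<^sup>T \<Sigma> S\<close> this yields \<open>conditional_error_tail\<close>, from which both claims
  follow. For the first take \<open>L = ln (1 / \<delta>)\<close>; the linear event has probability at most \<open>exp (- c n)\<close>
  unless the exponent in the claim is so small that the claim is trivial. For the second take
  \<open>L = \<parallel>\<theta>\<parallel>\<^sup>2 / \<parallel>\<Sigma>\<parallel>\<close>: both exceptional probabilities are then at most of the order of the bound itself, so
  no term \<open>exp (- c n)\<close> remains.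

  The noise law is given only through its linear functionals, so the quadratic form \<open>S\<^sup>T \<Sigma> S\<close> has to
  be reduced to them: with eigenvalues \<open>l\<^sub>k\<close> and coordinates
  \<open>x\<^sub>k\<close> of \<open>x\<close> in an orthonormal eigenbasis of \<open>\<Sigma>\<close>, the identity
  \<open>exp (s x\<^sup>T \<Sigma> x) = E exp (\<Sum>k<p. sqrt (2 s l\<^sub>k) z\<^sub>k x\<^sub>k)\<close> for independent standard normal \<open>z\<^sub>k\<close>
  turns its exponential moment into an average of moments of linear functionals
  (\<open>quad_form_mgf_le\<close>). The eigenbasis is provided by \<open>real_symmetric_diagonalization\<close>.
\<close>

section \<open>The spectral theorem for real symmetric matrices\<close>

text \<open>Over the complex numbers an eigenvector \<open>x\<close> exists. The number \<open>x\<^sup>* A x\<close> equals its own conjugate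
because \<open>A\<close> is real and symmetric, and it equals the eigenvalue times \<open>\<parallel>x\<parallel>\<^sup>2\<close>; so the eigenvalue is
real, and it is a root of the real characteristic polynomial.\<close>

lemma symmetric_real_eigenvalue_exists:
  fixes A :: "real mat"
  assumes A: "A \<in> carrier_mat p p" and sym: "transpose_mat A = A" and p: "p \<noteq> 0"
  shows "\<exists>e. eigenvalue A e"
proof -
  let ?A = "map_mat complex_of_real A"
  have Ac: "?A \<in> carrier_mat p p" using A by simp
  obtain \<mu> where ev: "eigenvalue ?A \<mu>"
    using spectrum_non_empty[OF Ac] p by (auto simp: spectrum_def)
  then obtain x where x: "x \<in> carrier_vec p" "x \<noteq> 0\<^sub>v p" "?A *\<^sub>v x = \<mu> \<cdot>\<^sub>v x"
    using Ac by (auto simp: eigenvalue_def eigenvector_def)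
  define S where "S = (\<Sum>i<p. \<Sum>j<p. cnj (x $ i) * (complex_of_real (A $$ (i, j)) * x $ j))"
  define q where "q = (\<Sum>i<p. (cmod (x $ i))\<^sup>2)"
  have row: "(\<Sum>j<p. complex_of_real (A $$ (i, j)) * x $ j) = \<mu> * x $ i" if "i < p" for i
  proof -
    have "(?A *\<^sub>v x) $ i = (\<Sum>j<p. complex_of_real (A $$ (i, j)) * x $ j)"
      using that A x(1) by (auto simp: scalar_prod_def atLeast0LessThan intro!: sum.cong)
    then show ?thesis using x that by auto
  qed
  have "S = (\<Sum>i<p. cnj (x $ i) * (\<mu> * x $ i))"
    unfolding S_def by (intro sum.cong refl) (simp add: row flip: sum_distrib_left)
  also have "\<dots> = \<mu> * (\<Sum>i<p. x $ i * cnj (x $ i))"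
    by (simp add: sum_distrib_left mult_ac)
  also have "(\<Sum>i<p. x $ i * cnj (x $ i)) = complex_of_real q"
    by (simp only: q_def of_real_sum complex_norm_square)
  finally have S: "S = \<mu> * complex_of_real q" .
  have Aij: "A $$ (j, i) = A $$ (i, j)" if "i < p" "j < p" for i j
    using arg_cong[OF sym, of "\<lambda>M. M $$ (i, j)"] that A by simp
  have "cnj S = (\<Sum>i<p. \<Sum>j<p. x $ i * (complex_of_real (A $$ (i, j)) * cnj (x $ j)))"
    by (simp add: S_def)
  also have "\<dots> = (\<Sum>j<p. \<Sum>i<p. x $ i * (complex_of_real (A $$ (i, j)) * cnj (x $ j)))"
    by (rule sum.swap)
  also have "\<dots> = S"
    unfolding S_def by (intro sum.cong refl) (simp add: Aij mult_ac)
  finally have "cnj \<mu> * complex_of_real q = \<mu> * complex_of_real q" using S by simp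
  moreover have "q \<noteq> 0"
  proof
    assume "q = 0"
    then have "x $ i = 0" if "i < p" for i
      using that unfolding q_def by (subst (asm) sum_nonneg_eq_0_iff) auto
    then show False using x by (auto intro!: eq_vecI)
  qed
  ultimately have "cnj \<mu> = \<mu>" by simp
  then obtain e where e: "\<mu> = complex_of_real e" by (metis Reals_cnj_iff Reals_cases)
  have "poly (map_poly of_real (char_poly A)) (complex_of_real e) = 0"
    using ev e eigenvalue_root_char_poly[OF Ac] by (simp add: of_real_hom.char_poly_hom[OF A])
  then have "poly (char_poly A) e = 0" by (simp add: of_real_hom.poly_map_poly)
  then show ?thesis using eigenvalue_root_char_poly[OF A] by auto
qed

text \<open>The Householder reflection \<open>1 - c u u\<^sup>T\<close> along \<open>u = e\<^sub>0 - v\<close>. It serves as an orthogonal matrix with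
prescribed first column, in place of the completion of \<open>v\<close> to an orthonormal basis.\<close>

lemma reflection_onto_unit_vector:
  fixes v :: "real vec"
  assumes v: "v \<in> carrier_vec p" "v \<bullet> v = 1" and p: "p > 0"
  shows "\<exists>H \<in> carrier_mat p p. transpose_mat H = H \<and> H * H = 1\<^sub>m p \<and> H *\<^sub>v unit_vec p 0 = v"
proof -
  define \<delta> :: "nat \<Rightarrow> nat \<Rightarrow> real" where "\<delta> i j = (if i = j then 1 else 0)" for i j
  define u where "u i = \<delta> i 0 - v $ i" for i
  \<comment> \<open>Twice the inverse of \<open>u \<bullet> u = 2 (1 - v\<^sub>0)\<close>. If \<open>v\<close> is the first unit vector, then \<open>c = 0\<close> and \<open>H\<close>
    is the identity.\<close>
  define c where "c = inverse (1 - v $ 0)"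
  define H where "H = mat p p (\<lambda>(i, j). \<delta> i j - c * u i * u j)"
  have vv: "(\<Sum>k<p. v $ k * v $ k) = 1"
    using v by (simp add: scalar_prod_def atLeast0LessThan)
  have "(\<Sum>k<p. u k * u k) = (\<Sum>k<p. \<delta> k 0 * (1 - 2 * v $ k) + v $ k * v $ k)"
    by (intro sum.cong) (auto simp: u_def \<delta>_def algebra_simps)
  also have "\<dots> = (\<Sum>k<p. \<delta> k 0 * (1 - 2 * v $ k)) + 1"
    by (simp add: sum.distrib vv)
  also have "(\<Sum>k<p. \<delta> k 0 * (1 - 2 * v $ k)) = 1 - 2 * v $ 0"
    using p by (simp add: \<delta>_def if_distrib[of "\<lambda>x. x * _"] sum.delta cong: if_cong)
  finally have uu: "(\<Sum>k<p. u k * u k) = 2 * (1 - v $ 0)" by simp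
  have cu: "c * u 0 * u i = u i" if "i < p" for i
  proof (cases "v $ 0 = 1")
    case True
    then have "(\<Sum>k<p. u k * u k) = 0" using uu by simp
    then have "u i = 0" using that by (subst (asm) sum_nonneg_eq_0_iff) auto
    then show ?thesis by simp
  next
    case False
    then show ?thesis by (simp add: c_def u_def[of 0] \<delta>_def)
  qed
  have ccu: "c * c * (\<Sum>k<p. u k * u k) = 2 * c"
    unfolding uu c_def by (cases "v $ 0 = 1") (auto simp: divide_simps)
  have H: "H \<in> carrier_mat p p" by (simp add: H_def)
  have "H * H = 1\<^sub>m p"
  proof (rule eq_matI)
    fix i j assume ij: "i < dim_row (1\<^sub>m p :: real mat)" "j < dim_col (1\<^sub>m p :: real mat)"
    have "(H * H) $$ (i, j) = (\<Sum>k<p. (\<delta> i k - c * u i * u k) * (\<delta> k j - c * u k * u j))"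
      using ij by (simp add: H_def scalar_prod_def atLeast0LessThan)
    also have "\<dots> = (\<Sum>k<p. (if k = i then \<delta> i j - c * u i * u j else 0)
         - (if k = j then c * u i * u j else 0) + u i * u j * (c * c * (u k * u k)))"
      by (intro sum.cong) (auto simp: \<delta>_def algebra_simps)
    also have "\<dots> = \<delta> i j - 2 * (c * u i * u j) + u i * u j * (c * c * (\<Sum>k<p. u k * u k))"
      using ij by (simp add: sum.distrib sum_subtractf sum.delta flip: sum_distrib_left)
    also have "\<dots> = 1\<^sub>m p $$ (i, j)" unfolding ccu using ij by (simp add: \<delta>_def)
    finally show "(H * H) $$ (i, j) = 1\<^sub>m p $$ (i, j)" .
  qed (auto simp: H_def)
  moreover have "H *\<^sub>v unit_vec p 0 = v"
  proof (rule eq_vecI)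
    fix i assume i: "i < dim_vec v"
    then have ip: "i < p" using v by simp
    have "(H *\<^sub>v unit_vec p 0) $ i = H $$ (i, 0)"
      using ip p H by simp
    also have "\<dots> = \<delta> i 0 - c * u 0 * u i" using ip p by (simp add: H_def mult_ac)
    also have "\<dots> = \<delta> i 0 - u i" using cu[OF ip] by simp
    also have "\<dots> = v $ i" by (simp add: u_def)
    finally show "(H *\<^sub>v unit_vec p 0) $ i = v $ i" .
  qed (use v H in auto)
  moreover have "transpose_mat H = H"
    by (rule eq_matI) (auto simp: H_def \<delta>_def)
  ultimately show ?thesis using H by blast
qed

lemma block_diagonal_mult:
  fixes a b M N :: "real mat"
  assumes a: "a \<in> carrier_mat k k" and b: "b \<in> carrier_mat k k"
    and M: "M \<in> carrier_mat p p" and N: "N \<in> carrier_mat p p"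
  shows "four_block_mat a (0\<^sub>m k p) (0\<^sub>m p k) M * four_block_mat b (0\<^sub>m k p) (0\<^sub>m p k) N =
    four_block_mat (a * b) (0\<^sub>m k p) (0\<^sub>m p k) (M * N)"
  using assms by (subst mult_four_block_mat[of _ k k _ p _ p]) auto

text \<open>Induction on the dimension by deflation: conjugating with a reflection that maps the first unit
vector to a unit eigenvector makes the first column and, by symmetry, the first row of the matrix
vanish off the diagonal. The remaining block is again symmetric.\<close>

theorem real_symmetric_diagonalization:
  fixes A :: "real mat"
  assumes "A \<in> carrier_mat p p" and "transpose_mat A = A"
  shows "\<exists>U l. U \<in> carrier_mat p p \<and> transpose_mat U * U = 1\<^sub>m p \<and>
     A = U * mat_diag p l * transpose_mat U"
  using assms
proof (induction p arbitrary: A)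
  case 0
  then show ?case
    by (intro exI[of _ "1\<^sub>m 0"] exI[of _ "\<lambda>_. 0"]) (auto intro!: eq_matI)
next
  case (Suc p)
  let ?n = "Suc p"
  note A = Suc.prems(1)
  obtain e w where w: "w \<in> carrier_vec ?n" "w \<noteq> 0\<^sub>v ?n" "A *\<^sub>v w = e \<cdot>\<^sub>v w"
    using symmetric_real_eigenvalue_exists[OF Suc.prems] A
    by (auto simp: eigenvalue_def eigenvector_def)
  have ww: "w \<bullet> w > 0" using conjugate_square_greater_0_vec[OF w(1)] w(2) by simp
  define v where "v = (1 / sqrt (w \<bullet> w)) \<cdot>\<^sub>v w"
  have v: "v \<in> carrier_vec ?n" "v \<bullet> v = 1" "A *\<^sub>v v = e \<cdot>\<^sub>v v"
    using w ww A by (auto simp: v_def mult_mat_vec[of A ?n ?n] smult_smult_assoc mult.commute)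
  obtain H where H: "H \<in> carrier_mat ?n ?n" "transpose_mat H = H" "H * H = 1\<^sub>m ?n"
    "H *\<^sub>v unit_vec ?n 0 = v"
    using reflection_onto_unit_vector[OF v(1,2)] by auto
  note assoc = assoc_mult_mat[of _ ?n ?n _ ?n _ ?n]
  define B where "B = H * A * H"
  have B: "B \<in> carrier_mat ?n ?n" using H A by (simp add: B_def)
  have symB: "transpose_mat B = B"
    using H A Suc.prems(2) by (simp add: B_def transpose_mult[of _ ?n ?n _ ?n] assoc)
  have AB: "A = H * B * H"
  proof -
    have "H * B * H = (H * H) * A * (H * H)"
      using H(1) A by (simp add: B_def assoc)
    then show ?thesis using A H by simp
  qed
  have Hv: "H *\<^sub>v v = unit_vec ?n 0"
    using H by (simp add: H(4)[symmetric] assoc_mult_mat_vec[of _ ?n ?n _ ?n, symmetric])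
  have "B *\<^sub>v unit_vec ?n 0 = H *\<^sub>v (A *\<^sub>v (H *\<^sub>v unit_vec ?n 0))"
    using H A by (simp add: B_def assoc_mult_mat_vec[of _ ?n ?n _ ?n])
  also have "\<dots> = e \<cdot>\<^sub>v unit_vec ?n 0"
    using H v by (simp add: mult_mat_vec[of H ?n ?n] Hv)
  finally have B0: "B *\<^sub>v unit_vec ?n 0 = e \<cdot>\<^sub>v unit_vec ?n 0" .
  have col: "B $$ (i, 0) = (if i = 0 then e else 0)" if "i < ?n" for i
    using arg_cong[OF B0, of "\<lambda>x. x $ i"] that B by simp
  have sB: "B $$ (j, i) = B $$ (i, j)" if "i < ?n" "j < ?n" for i j
    using arg_cong[OF symB, of "\<lambda>M. M $$ (i, j)"] that B by simp
  define B' where "B' = mat p p (\<lambda>(i, j). B $$ (Suc i, Suc j))"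
  have B': "B' \<in> carrier_mat p p" "transpose_mat B' = B'"
    using sB by (auto simp: B'_def intro!: eq_matI)
  obtain V l where V: "V \<in> carrier_mat p p" "transpose_mat V * V = 1\<^sub>m p"
    "B' = V * mat_diag p l * transpose_mat V"
    using Suc.IH[OF B'] by blast
  define W where "W = four_block_mat (1\<^sub>m 1) (0\<^sub>m 1 p) (0\<^sub>m p 1) V"
  define l' where "l' = case_nat e l"
  have W: "W \<in> carrier_mat ?n ?n" using V four_block_carrier_mat[of "1\<^sub>m 1" 1 1 V p p] by (simp add: W_def)
  have WT: "transpose_mat W = four_block_mat (1\<^sub>m 1) (0\<^sub>m 1 p) (0\<^sub>m p 1) (transpose_mat V)"
    unfolding W_def using V by (subst transpose_four_block_mat) auto
  have D: "mat_diag ?n l' = four_block_mat (e \<cdot>\<^sub>m 1\<^sub>m 1) (0\<^sub>m 1 p) (0\<^sub>m p 1) (mat_diag p l)"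
    by (rule eq_matI) (auto simp: mat_diag_def l'_def split: nat.split)
  have BB: "B = four_block_mat (e \<cdot>\<^sub>m 1\<^sub>m 1) (0\<^sub>m 1 p) (0\<^sub>m p 1) B'"
  proof (rule eq_matI)
    fix i j assume "i < dim_row (four_block_mat (e \<cdot>\<^sub>m 1\<^sub>m 1) (0\<^sub>m 1 p) (0\<^sub>m p 1) B')"
      "j < dim_col (four_block_mat (e \<cdot>\<^sub>m 1\<^sub>m 1) (0\<^sub>m 1 p) (0\<^sub>m p 1) B')"
    then have "i < ?n" "j < ?n" by (auto simp: B'_def)
    then show "B $$ (i, j) = four_block_mat (e \<cdot>\<^sub>m 1\<^sub>m 1) (0\<^sub>m 1 p) (0\<^sub>m p 1) B' $$ (i, j)"
      using col[of i] col[of j] sB[of 0 j] by (auto simp: B'_def)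
  qed (use B in \<open>auto simp: B'_def\<close>)
  have VD: "V * mat_diag p l \<in> carrier_mat p p" using V(1) mat_diag_dim by (rule mult_carrier_mat)
  have BW: "B = W * mat_diag ?n l' * transpose_mat W"
    unfolding BB WT D V(3) unfolding W_def using V(1) VD mat_diag_dim[of p l]
    by (simp add: block_diagonal_mult one_carrier_mat del: One_nat_def)
  have WW: "transpose_mat W * W = 1\<^sub>m ?n"
    unfolding WT unfolding W_def using V(1,2)
    by (simp add: block_diagonal_mult del: One_nat_def) (auto intro!: eq_matI)
  have c: "mat_diag ?n l' \<in> carrier_mat ?n ?n" "transpose_mat W \<in> carrier_mat ?n ?n"
    "transpose_mat (H * W) = transpose_mat W * H"
    using W H by (auto simp: transpose_mult[of _ ?n ?n _ ?n])
  have "transpose_mat (H * W) * (H * W) = transpose_mat W * ((H * H) * W)"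
    using H(1) W c by (simp add: assoc)
  then have "transpose_mat (H * W) * (H * W) = 1\<^sub>m ?n" using WW W H by simp
  moreover have "H * (W * D * transpose_mat W) * H = (H * W) * D * (transpose_mat W * H)"
    if "D \<in> carrier_mat ?n ?n" for D
    using H(1) W c(2) that by (simp add: assoc mult_carrier_mat[of _ ?n ?n _ ?n])
  from this[OF c(1)] have "A = (H * W) * mat_diag ?n l' * transpose_mat (H * W)"
    unfolding AB BW c(3) .
  ultimately show ?case using H(1) W by (intro exI[of _ "H * W"] exI[of _ l']) auto
qed

section \<open>Coordinates in an orthonormal eigenbasis\<close>

lemma mat_trace_commute:
  assumes "X \<in> carrier_mat m n" "Y \<in> carrier_mat n m"
  shows "mat_trace (X * Y) = mat_trace (Y * X)"
proof -
  have "mat_trace (X * Y) = (\<Sum>i<m. \<Sum>j<n. X $$ (i, j) * Y $$ (j, i))"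
    using assms by (auto simp: mat_trace_def scalar_prod_def atLeast0LessThan intro!: sum.cong)
  also have "\<dots> = (\<Sum>j<n. \<Sum>i<m. Y $$ (j, i) * X $$ (i, j))"
    by (subst sum.swap) (simp add: mult.commute)
  also have "\<dots> = mat_trace (Y * X)"
    using assms by (auto simp: mat_trace_def scalar_prod_def atLeast0LessThan intro!: sum.cong)
  finally show ?thesis .
qed

text \<open>The columns of \<open>U\<close> are an orthonormal eigenbasis of \<open>A\<close> with eigenvalues \<open>l\<close>. In the coordinates
with respect to this basis all quantities of the theorem become sums over eigenvalues.\<close>

locale orthogonal_diagonalization =
  fixes p :: nat and A U :: "real mat" and l :: "nat \<Rightarrow> real"
  assumes U: "U \<in> carrier_mat p p" and UU: "transpose_mat U * U = 1\<^sub>m p"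
    and A_eq: "A = U * mat_diag p l * transpose_mat U"
begin

lemma UU': "U * transpose_mat U = 1\<^sub>m p"
  using mat_mult_left_right_inverse[OF _ U UU] U by simp

lemma A_carrier: "A \<in> carrier_mat p p"
  using U mat_diag_dim[of p l] unfolding A_eq by (intro mult_carrier_mat) auto

text \<open>The same basis diagonalizes the square, so that every fact of this locale applies to it.\<close>

lemma square: "orthogonal_diagonalization p (A * A) U (\<lambda>k. (l k)\<^sup>2)"
proof
  let ?D = "mat_diag p l" and ?T = "transpose_mat U"
  have D: "?D \<in> carrier_mat p p" by simp
  have T: "?T \<in> carrier_mat p p" using U by simp
  note c = mult_carrier_mat[of _ p p _ p]
  have "(U * X * ?T) * (U * X * ?T) = U * (X * (?T * U) * X) * ?T" if "X \<in> carrier_mat p p" for X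
    using U T that by (simp add: assoc_mult_mat[of _ p p _ p _ p] c)
  from this[OF D] have "A * A = U * (?D * ?D) * ?T" unfolding A_eq UU using D by simp
  then show "A * A = U * mat_diag p (\<lambda>k. (l k)\<^sup>2) * ?T"
    by (simp add: power2_eq_square)
qed (use U UU in auto)

lemma trace: "mat_trace A = (\<Sum>k<p. l k)"
proof -
  let ?D = "mat_diag p l" and ?T = "transpose_mat U"
  have T: "?T \<in> carrier_mat p p" using U by simp
  have UD: "U * ?D \<in> carrier_mat p p" by (rule mult_carrier_mat[OF U]) simp
  have "?T * (U * ?D) = (?T * U) * ?D" by (rule assoc_mult_mat[OF T U mat_diag_dim, symmetric])
  then have "?T * (U * ?D) = ?D" by (simp add: UU left_mult_one_mat[OF mat_diag_dim])
  then have "mat_trace A = mat_trace ?D" unfolding A_eq using mat_trace_commute[OF UD T] by simp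
  then show ?thesis by (simp add: mat_trace_def mat_diag_def)
qed

lemma spectrum: "spectrum A = l ` {..<p}"
proof -
  let ?D = "mat_diag p l"
  have D: "?D \<in> carrier_mat p p" by simp
  have "similar_mat A ?D"
    by (rule similar_matI[of _ _ U "transpose_mat U" p]) (use A_carrier U UU UU' A_eq in auto)
  then have "char_poly A = char_poly ?D" by (rule char_poly_similar)
  also have "\<dots> = (\<Prod>a\<leftarrow>diag_mat ?D. [:- a, 1:])"
    by (rule char_poly_upper_triangular[OF D]) (auto simp: mat_diag_def)
  finally have "poly (char_poly A) x = 0 \<longleftrightarrow> x \<in> set (diag_mat ?D)" for x
    by (auto simp: poly_prod_list prod_list_zero_iff image_iff)
  then have "spectrum A = set (diag_mat ?D)"
    using spectrum_root_char_poly[OF A_carrier] by auto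
  also have "\<dots> = l ` {..<p}"
    by (auto simp: diag_mat_def mat_diag_def)
  finally show ?thesis .
qed

lemma largest_eigenvalue: "largest_eigenvalue A = Max (l ` {..<p})"
  by (simp add: largest_eigenvalue_def spectrum)

lemma eigenvalue_le_largest: "k < p \<Longrightarrow> l k \<le> largest_eigenvalue A"
  by (simp add: largest_eigenvalue)

lemma largest_eigenvalue_attained: "p > 0 \<Longrightarrow> \<exists>k<p. largest_eigenvalue A = l k"
proof -
  assume "p > 0"
  then have "Max (l ` {..<p}) \<in> l ` {..<p}" by (intro Max_in) auto
  then show ?thesis by (auto simp: largest_eigenvalue)
qed

definition coord :: "real vec \<Rightarrow> nat \<Rightarrow> real" where
  "coord x k = (transpose_mat U *\<^sub>v x) $ k"

definition from_coord :: "(nat \<Rightarrow> real) \<Rightarrow> real vec" where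
  "from_coord b = U *\<^sub>v vec p b"

lemma from_coord_carrier [simp]: "from_coord b \<in> carrier_vec p"
  using U by (simp add: from_coord_def)

lemma scalar_prod_from_coord:
  assumes "x \<in> carrier_vec p" shows "from_coord b \<bullet> x = (\<Sum>k<p. b k * coord x k)"
proof -
  have "from_coord b \<bullet> x = x \<bullet> (U *\<^sub>v vec p b)"
    using U assms by (simp add: from_coord_def comm_scalar_prod[of _ p])
  also have "\<dots> = (transpose_mat U *\<^sub>v x) \<bullet> vec p b"
    using transpose_vec_mult_scalar[OF U vec_carrier assms, of b] by simp
  also have "\<dots> = (\<Sum>k<p. b k * coord x k)"
    by (simp add: scalar_prod_def coord_def atLeast0LessThan mult.commute)
  finally show ?thesis .
qed

lemma coord_from_coord: "k < p \<Longrightarrow> coord (from_coord b) k = b k"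
  using U by (simp add: coord_def from_coord_def UU
    assoc_mult_mat_vec[of _ p p U p, symmetric])

lemma from_coord_coord:
  assumes "x \<in> carrier_vec p" shows "from_coord (coord x) = x"
proof -
  have "vec p (coord x) = transpose_mat U *\<^sub>v x"
    using U by (auto simp: coord_def intro!: eq_vecI)
  then show ?thesis using U assms by (simp add: from_coord_def UU'
    assoc_mult_mat_vec[of _ p p _ p, symmetric])
qed

lemma norm_coord: "x \<in> carrier_vec p \<Longrightarrow> x \<bullet> x = (\<Sum>k<p. (coord x k)\<^sup>2)"
  using scalar_prod_from_coord[of x "coord x"] by (simp add: from_coord_coord power2_eq_square)

lemma quad_form_coord:
  assumes "x \<in> carrier_vec p" shows "quad_form A x = (\<Sum>k<p. l k * (coord x k)\<^sup>2)"
proof -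
  have T: "transpose_mat U *\<^sub>v x \<in> carrier_vec p" using U assms by simp
  have "A *\<^sub>v x = U *\<^sub>v (mat_diag p l *\<^sub>v (transpose_mat U *\<^sub>v x))"
    unfolding A_eq using U assms mat_diag_dim[of p l] mult_carrier_mat[OF U mat_diag_dim, of l]
    by (simp add: assoc_mult_mat_vec[of _ p p _ p])
  also have "mat_diag p l *\<^sub>v (transpose_mat U *\<^sub>v x) = vec p (\<lambda>k. l k * coord x k)"
  proof (rule eq_vecI)
    fix k assume "k < dim_vec (vec p (\<lambda>k. l k * coord x k))"
    then have k: "k < p" by simp
    have "(mat_diag p l *\<^sub>v y) $ k = l k * y $ k" if "y \<in> carrier_vec p" for y
      using k that by (simp add: scalar_prod_def mat_diag_def if_distrib[of "\<lambda>z. z * _"] cong: if_cong)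
    from this[OF T] k show "(mat_diag p l *\<^sub>v (transpose_mat U *\<^sub>v x)) $ k = vec p (\<lambda>k. l k * coord x k) $ k"
      by (simp add: coord_def)
  qed (simp add: mat_diag_def)
  finally have "A *\<^sub>v x = from_coord (\<lambda>k. l k * coord x k)" by (simp add: from_coord_def)
  then show ?thesis using scalar_prod_from_coord[OF assms] assms
    by (simp add: quad_form_def comm_scalar_prod[of x p] power2_eq_square mult_ac)
qed

lemma quad_form_le_largest_eigenvalue:
  assumes "x \<in> carrier_vec p" shows "quad_form A x \<le> largest_eigenvalue A * (x \<bullet> x)"
  unfolding quad_form_coord[OF assms] norm_coord[OF assms] sum_distrib_left
  by (intro sum_mono mult_right_mono) (auto intro: eigenvalue_le_largest)

lemma eigenvalue_pos:
  assumes "pos_def_mat p A" "k < p" shows "l k > 0"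
proof -
  let ?x = "from_coord (\<lambda>j. if j = k then 1 else 0)"
  have "coord ?x k = 1" using assms by (simp add: coord_from_coord)
  moreover have "coord (0\<^sub>v p) k = 0" using U assms by (simp add: coord_def)
  ultimately have "?x \<noteq> 0\<^sub>v p" by (intro notI) simp
  then have "quad_form A ?x > 0" using assms by (auto simp: pos_def_mat_def)
  also have "quad_form A ?x = (\<Sum>j<p. if j = k then l j else 0)"
    by (subst quad_form_coord, simp, intro sum.cong refl) (auto simp: coord_from_coord)
  finally show ?thesis using assms by (simp split: if_splits)
qed

lemma largest_eigenvalue_pos:
  assumes "pos_def_mat p A" "p > 0" shows "largest_eigenvalue A > 0"
  using largest_eigenvalue_attained[OF assms(2)] eigenvalue_pos[OF assms(1)] by auto

lemma largest_eigenvalue_square: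
  assumes "pos_def_mat p A" "p > 0"
  shows "largest_eigenvalue (A * A) = (largest_eigenvalue A)\<^sup>2"
proof -
  interpret sq: orthogonal_diagonalization p "A * A" U "\<lambda>k. (l k)\<^sup>2" by (rule square)
  show ?thesis
  proof (rule antisym)
    show "largest_eigenvalue (A * A) \<le> (largest_eigenvalue A)\<^sup>2"
    proof -
      obtain k where "k < p" "largest_eigenvalue (A * A) = (l k)\<^sup>2"
        using sq.largest_eigenvalue_attained[OF assms(2)] by blast
      then show ?thesis
        using eigenvalue_le_largest[of k] eigenvalue_pos[OF assms(1), of k] by (simp add: power_mono)
    qed
    show "(largest_eigenvalue A)\<^sup>2 \<le> largest_eigenvalue (A * A)"
      using largest_eigenvalue_attained[OF assms(2)] sq.eigenvalue_le_largest by auto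
  qed
qed

end

lemma pos_def_mat_carrier: "pos_def_mat p A \<Longrightarrow> A \<in> carrier_mat p p"
  by (simp add: pos_def_mat_def)

lemma quad_form_smult:
  assumes "B \<in> carrier_mat p p" "v \<in> carrier_vec p"
  shows "quad_form B (c \<cdot>\<^sub>v v) = c\<^sup>2 * quad_form B v"
  using assms by (simp add: quad_form_def mult_mat_vec[of B p p] power2_eq_square mult_ac)

lemma pos_def_diagonalization_exists:
  assumes "pos_def_mat p A" shows "\<exists>U l. orthogonal_diagonalization p A U l"
  using real_symmetric_diagonalization[of A p] assms
  by (auto simp: pos_def_mat_def orthogonal_diagonalization_def)

lemma quad_form_add_le:
  assumes A: "pos_def_mat p A" and x: "x \<in> carrier_vec p" and y: "y \<in> carrier_vec p"
  shows "quad_form A (x + y) \<le> 2 * quad_form A x + 2 * quad_form A y"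
proof -
  obtain U l where "orthogonal_diagonalization p A U l"
    using pos_def_diagonalization_exists[OF A] by blast
  then interpret orthogonal_diagonalization p A U l .
  have "coord (x + y) k = coord x k + coord y k" if "k < p" for k
    using U x y that by (simp add: coord_def mult_add_distrib_mat_vec[of _ p p])
  then have "quad_form A (x + y) = (\<Sum>k<p. l k * (coord x k + coord y k)\<^sup>2)"
    using x y by (simp add: quad_form_coord)
  also have "\<dots> \<le> (\<Sum>k<p. l k * (2 * (coord x k)\<^sup>2 + 2 * (coord y k)\<^sup>2))"
  proof (intro sum_mono mult_left_mono)
    show "(coord x k + coord y k)\<^sup>2 \<le> 2 * (coord x k)\<^sup>2 + 2 * (coord y k)\<^sup>2" for k
      using sum_squares_bound[of "coord x k" "coord y k"] by (simp add: power2_sum)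
  qed (auto intro: less_imp_le eigenvalue_pos[OF A])
  also have "\<dots> = 2 * quad_form A x + 2 * quad_form A y"
    using x y by (simp add: quad_form_coord sum_distrib_left sum.distrib algebra_simps)
  finally show ?thesis .
qed

lemma quad_form_nonneg: "pos_def_mat p A \<Longrightarrow> x \<in> carrier_vec p \<Longrightarrow> quad_form A x \<ge> 0"
  by (cases "x = 0\<^sub>v p") (auto simp: pos_def_mat_def quad_form_def intro: less_imp_le)

lemma self_scalar_prod_pos: "(x :: real vec) \<in> carrier_vec p \<Longrightarrow> x \<noteq> 0\<^sub>v p \<Longrightarrow> x \<bullet> x > 0"
  using conjugate_square_greater_0_vec[of x p] by simp

section \<open>Measurability of vector-valued maps\<close>

lemma space_borel_vec [simp]: "space (borel_vec p) = carrier_vec p"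
  by (simp add: borel_vec_def)

lemma measurable_vec_index:
  assumes "i < p" shows "(\<lambda>v. v $ i) \<in> borel_measurable (borel_vec p)"
proof -
  have "(\<lambda>v. \<lambda>i\<in>{..<p}. v $ i) \<in> measurable (borel_vec p) (Pi\<^sub>M {..<p} (\<lambda>_. borel))"
    unfolding borel_vec_def by (rule measurable_vimage_algebra1) (auto simp: space_PiM)
  from measurable_compose[OF this measurable_component_singleton[of i]] assms show ?thesis by simp
qed

lemma measurable_borel_vecI:
  assumes "\<And>\<omega>. \<omega> \<in> space M \<Longrightarrow> f \<omega> \<in> carrier_vec p"
    and "\<And>i. i < p \<Longrightarrow> (\<lambda>\<omega>. f \<omega> $ i) \<in> borel_measurable M"
  shows "f \<in> measurable M (borel_vec p)"
  unfolding borel_vec_def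
  by (rule measurable_vimage_algebra2) (use assms in \<open>auto intro!: measurable_restrict\<close>)

lemma borel_measurable_scalar_prod [measurable (raw)]:
  assumes "f \<in> measurable M (borel_vec p)" "g \<in> measurable M (borel_vec p)"
  shows "(\<lambda>\<omega>. f \<omega> \<bullet> g \<omega>) \<in> borel_measurable M"
proof -
  have "(\<lambda>\<omega>. \<Sum>i<p. f \<omega> $ i * g \<omega> $ i) \<in> borel_measurable M"
    using measurable_compose[OF assms(1) measurable_vec_index] measurable_compose[OF assms(2) measurable_vec_index]
    by (intro borel_measurable_sum borel_measurable_times) auto
  moreover have "(\<Sum>i<p. f \<omega> $ i * g \<omega> $ i) = f \<omega> \<bullet> g \<omega>" if "\<omega> \<in> space M" for \<omega>
    using measurable_space[OF assms(2) that] by (auto simp: scalar_prod_def atLeast0LessThan)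
  ultimately show ?thesis by (subst measurable_cong[where g="\<lambda>\<omega>. \<Sum>i<p. f \<omega> $ i * g \<omega> $ i"]) auto
qed

lemma borel_measurable_scalar_prod_const:
  assumes "a \<in> carrier_vec p" "f \<in> measurable M (borel_vec p)"
  shows "(\<lambda>\<omega>. a \<bullet> f \<omega>) \<in> borel_measurable M"
  by (rule borel_measurable_scalar_prod[of _ _ p]) (use assms in auto)

lemma measurable_mult_mat_vec:
  assumes "B \<in> carrier_mat p p" "f \<in> measurable M (borel_vec p)"
  shows "(\<lambda>\<omega>. B *\<^sub>v f \<omega>) \<in> measurable M (borel_vec p)"
proof (rule measurable_borel_vecI)
  fix i assume "i < p"
  then show "(\<lambda>\<omega>. (B *\<^sub>v f \<omega>) $ i) \<in> borel_measurable M"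
    using assms borel_measurable_scalar_prod_const[OF _ assms(2), of "row B i"] by simp
next
  fix \<omega> assume "\<omega> \<in> space M"
  then show "B *\<^sub>v f \<omega> \<in> carrier_vec p"
    using measurable_space[OF assms(2)] assms(1) by (intro mult_mat_vec_carrier) auto
qed

lemma borel_measurable_quad_form:
  assumes "B \<in> carrier_mat p p" "f \<in> measurable M (borel_vec p)"
  shows "(\<lambda>\<omega>. quad_form B (f \<omega>)) \<in> borel_measurable M"
  unfolding quad_form_def
  by (intro borel_measurable_scalar_prod[of _ _ p] measurable_mult_mat_vec assms)

section \<open>Gaussian exponential moments and tail bounds\<close>

lemma nn_integral_normal_density_exp:
  assumes "\<sigma> > 0"
  shows "(\<integral>\<^sup>+x. ennreal (normal_density 0 \<sigma> x) * ennreal (exp (t * x)) \<partial>lborel) = ennreal (exp (t\<^sup>2 * \<sigma>\<^sup>2 / 2))"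
proof -
  have *: "normal_density 0 \<sigma> x * exp (t * x) = exp (t\<^sup>2 * \<sigma>\<^sup>2 / 2) * normal_density (\<sigma>\<^sup>2 * t) \<sigma> x" for x
  proof -
    have "- x\<^sup>2 / (2 * \<sigma>\<^sup>2) + t * x = t\<^sup>2 * \<sigma>\<^sup>2 / 2 + - (x - \<sigma>\<^sup>2 * t)\<^sup>2 / (2 * \<sigma>\<^sup>2)"
      using assms by (simp add: field_simps power2_eq_square)
    then show ?thesis by (simp add: normal_density_def flip: exp_add)
  qed
  have "(\<integral>\<^sup>+x. ennreal (normal_density 0 \<sigma> x) * ennreal (exp (t * x)) \<partial>lborel) =
      (\<integral>\<^sup>+x. ennreal (exp (t\<^sup>2 * \<sigma>\<^sup>2 / 2)) * ennreal (normal_density (\<sigma>\<^sup>2 * t) \<sigma> x) \<partial>lborel)"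
    by (intro nn_integral_cong) (simp add: * flip: ennreal_mult)
  also have "\<dots> = ennreal (exp (t\<^sup>2 * \<sigma>\<^sup>2 / 2))"
    using assms by (simp add: nn_integral_cmult nn_integral_eq_integral integrable_normal_density)
  finally show ?thesis .
qed

lemma std_normal_mgf:
  "(\<integral>\<^sup>+x. ennreal (exp (t * x)) \<partial>density lborel std_normal_density) = ennreal (exp (t\<^sup>2 / 2))"
  using nn_integral_normal_density_exp[of 1 t] by (simp add: nn_integral_density)

text \<open>The exact value is \<open>1 / sqrt (1 - 2 t)\<close>; the exponential upper bound is what makes the product over
the coordinates collapse to a trace.\<close>

lemma std_normal_square_mgf_le:
  assumes "0 \<le> t" "t \<le> 1/4"
  shows "(\<integral>\<^sup>+x. ennreal (exp (t * x\<^sup>2)) \<partial>density lborel std_normal_density) \<le> ennreal (exp (2 * t))"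
proof -
  define \<sigma> where "\<sigma> = 1 / sqrt (1 - 2 * t)"
  have \<sigma>: "\<sigma> > 0" "\<sigma>\<^sup>2 = 1 / (1 - 2 * t)" using assms by (auto simp: \<sigma>_def power_divide)
  have *: "std_normal_density x * exp (t * x\<^sup>2) = \<sigma> * normal_density 0 \<sigma> x" for x
  proof -
    have "- x\<^sup>2 / 2 + t * x\<^sup>2 = - x\<^sup>2 / (2 * \<sigma>\<^sup>2)"
      unfolding \<sigma> using assms by (simp add: field_simps)
    then have "exp (- x\<^sup>2 / 2) * exp (t * x\<^sup>2) = exp (- x\<^sup>2 / (2 * \<sigma>\<^sup>2))" by (simp flip: exp_add)
    then show ?thesis using \<sigma>(1) by (simp add: normal_density_def real_sqrt_mult)
  qed
  have "(\<integral>\<^sup>+x. ennreal (exp (t * x\<^sup>2)) \<partial>density lborel std_normal_density) =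
      (\<integral>\<^sup>+x. ennreal \<sigma> * ennreal (normal_density 0 \<sigma> x) \<partial>lborel)"
    using \<sigma>(1) by (subst nn_integral_density) (auto simp flip: ennreal_mult * intro!: nn_integral_cong)
  also have "\<dots> = ennreal \<sigma>"
    using \<sigma>(1) by (simp add: nn_integral_cmult nn_integral_eq_integral integrable_normal_density)
  also have "\<sigma> \<le> exp (2 * t)"
  proof (rule power2_le_imp_le)
    \<comment> \<open>On \<open>[0, 1/4]\<close> the linear part of \<open>exp (4 t)\<close> already dominates \<open>1 / (1 - 2 t)\<close>.\<close>
    have "(1 - 2 * t) * (1 + 4 * t) = 1 + 2 * t * (1 - 4 * t)" by (simp add: algebra_simps)
    moreover have "2 * t * (1 - 4 * t) \<ge> 0" using assms by simp
    ultimately have "1 \<le> (1 - 2 * t) * (1 + 4 * t)" by linarith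
    also have "\<dots> \<le> (1 - 2 * t) * exp (4 * t)" using assms by (intro mult_left_mono) auto
    finally show "\<sigma>\<^sup>2 \<le> (exp (2 * t))\<^sup>2" using assms
      by (simp add: \<sigma> field_simps flip: exp_double)
  qed simp
  finally show ?thesis by (simp add: ennreal_leI)
qed

lemma (in prob_space) chernoff_bound:
  assumes f: "f \<in> borel_measurable M" and le: "(\<integral>\<^sup>+\<omega>. ennreal (exp (f \<omega>)) \<partial>M) \<le> ennreal (exp b)"
  shows "prob {\<omega> \<in> space M. f \<omega> \<ge> t} \<le> exp (b - t)"
proof -
  have "emeasure M {\<omega> \<in> space M. f \<omega> \<ge> t} = (\<integral>\<^sup>+\<omega>. indicator {\<omega> \<in> space M. f \<omega> \<ge> t} \<omega> \<partial>M)"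
    using f by simp
  also have "\<dots> \<le> (\<integral>\<^sup>+\<omega>. ennreal (exp (- t)) * ennreal (exp (f \<omega>)) \<partial>M)"
    by (intro nn_integral_mono) (auto simp: indicator_def simp flip: ennreal_mult exp_add)
  also have "\<dots> = ennreal (exp (- t)) * (\<integral>\<^sup>+\<omega>. ennreal (exp (f \<omega>)) \<partial>M)"
    using f by (intro nn_integral_cmult) simp
  also have "\<dots> \<le> ennreal (exp (- t)) * ennreal (exp b)" by (intro mult_left_mono le) simp
  also have "\<dots> = ennreal (exp (b - t))" by (simp flip: ennreal_mult exp_add)
  finally show ?thesis by (simp add: emeasure_eq_measure)
qed

text \<open>The random vector \<open>X\<close> is sub-Gaussian with variance proxy \<open>\<kappa> A\<close>. This is the only information
about the noise that the tail bounds use, and it involves linear functionals of \<open>X\<close> only.\<close>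

definition vec_mgf_le :: "nat \<Rightarrow> real mat \<Rightarrow> real \<Rightarrow> 'a measure \<Rightarrow> ('a \<Rightarrow> real vec) \<Rightarrow> bool" where
  "vec_mgf_le p A \<kappa> M X \<longleftrightarrow> X \<in> measurable M (borel_vec p) \<and>
     (\<forall>a \<in> carrier_vec p. (\<integral>\<^sup>+\<omega>. ennreal (exp (a \<bullet> X \<omega>)) \<partial>M) \<le> ennreal (exp (\<kappa> * quad_form A a / 2)))"

lemma (in prob_space) linear_tail:
  assumes X: "vec_mgf_le p A \<kappa> M X" and A: "A \<in> carrier_mat p p" and a: "a \<in> carrier_vec p"
    and pos: "\<kappa> * quad_form A a > 0" and r: "r \<ge> 0"
  shows "prob {\<omega> \<in> space M. a \<bullet> X \<omega> \<ge> r} \<le> exp (- (r\<^sup>2 / (2 * (\<kappa> * quad_form A a))))"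
proof -
  define q where "q = \<kappa> * quad_form A a"
  \<comment> \<open>The minimizer of \<open>c\<^sup>2 q / 2 - c r\<close>.\<close>
  define c where "c = r / q"
  have q: "q > 0" using pos by (simp add: q_def)
  have c: "c \<ge> 0" using q r by (simp add: c_def)
  have Xm: "X \<in> measurable M (borel_vec p)" using X by (simp add: vec_mgf_le_def)
  have cX: "(c \<cdot>\<^sub>v a) \<bullet> X \<omega> = c * (a \<bullet> X \<omega>)" if "\<omega> \<in> space M" for \<omega>
    using a measurable_space[OF Xm that] by simp
  have "(\<integral>\<^sup>+\<omega>. ennreal (exp (c * (a \<bullet> X \<omega>))) \<partial>M) = (\<integral>\<^sup>+\<omega>. ennreal (exp ((c \<cdot>\<^sub>v a) \<bullet> X \<omega>)) \<partial>M)"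
    by (intro nn_integral_cong) (simp add: cX)
  also have "\<dots> \<le> ennreal (exp (\<kappa> * quad_form A (c \<cdot>\<^sub>v a) / 2))"
    using X a by (auto simp: vec_mgf_le_def)
  also have "\<kappa> * quad_form A (c \<cdot>\<^sub>v a) / 2 = c\<^sup>2 * q / 2"
    by (simp add: quad_form_smult[OF A a] q_def)
  finally have "prob {\<omega> \<in> space M. c * (a \<bullet> X \<omega>) \<ge> c * r} \<le> exp (c\<^sup>2 * q / 2 - c * r)"
    using borel_measurable_scalar_prod_const[OF a Xm] by (intro chernoff_bound) auto
  moreover have "prob {\<omega> \<in> space M. a \<bullet> X \<omega> \<ge> r} \<le> prob {\<omega> \<in> space M. c * (a \<bullet> X \<omega>) \<ge> c * r}"
    using borel_measurable_scalar_prod_const[OF a Xm] c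
    by (intro finite_measure_mono) (auto intro: mult_left_mono)
  moreover have "c\<^sup>2 * q / 2 - c * r = - (r\<^sup>2 / (2 * q))"
    using q by (simp add: c_def field_simps power2_eq_square)
  ultimately show ?thesis by (simp add: q_def)
qed

context orthogonal_diagonalization
begin

lemma measurable_coord:
  assumes "f \<in> measurable M (borel_vec p)" "k < p"
  shows "(\<lambda>\<omega>. coord (f \<omega>) k) \<in> borel_measurable M"
  unfolding coord_def
  using measurable_compose[OF measurable_mult_mat_vec[OF _ assms(1)] measurable_vec_index[OF assms(2)]] U
  by simp

text \<open>Each factor \<open>exp (s l\<^sub>k x\<^sub>k\<^sup>2)\<close> is the exponential moment of a standard normal variable at
\<open>sqrt (2 s l\<^sub>k) x\<^sub>k\<close>. The exponential of a quadratic form thus becomes an average of exponentials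
of linear functionals.\<close>

lemma exp_quad_form_linearization:
  assumes x: "x \<in> carrier_vec p" and s: "s \<ge> 0" and l: "\<And>k. k < p \<Longrightarrow> l k \<ge> 0"
  shows "(\<integral>\<^sup>+z. ennreal (exp (from_coord (\<lambda>k. sqrt (2 * s * l k) * z k) \<bullet> x))
      \<partial>Pi\<^sub>M {..<p} (\<lambda>_. density lborel std_normal_density)) = ennreal (exp (s * quad_form A x))"
proof -
  interpret std: prob_space "density lborel std_normal_density" by (rule prob_space_normal_density) simp
  interpret P: product_prob_space "\<lambda>_. density lborel std_normal_density" "{..<p}" by standard
  have "exp (from_coord (\<lambda>k. sqrt (2 * s * l k) * z k) \<bullet> x) =
      (\<Prod>k<p. exp (sqrt (2 * s * l k) * coord x k * z k))" for z
    by (simp add: scalar_prod_from_coord[OF x] exp_sum mult_ac)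
  then have "(\<integral>\<^sup>+z. ennreal (exp (from_coord (\<lambda>k. sqrt (2 * s * l k) * z k) \<bullet> x))
      \<partial>Pi\<^sub>M {..<p} (\<lambda>_. density lborel std_normal_density)) =
    (\<integral>\<^sup>+z. (\<Prod>k<p. ennreal (exp (sqrt (2 * s * l k) * coord x k * z k)))
      \<partial>Pi\<^sub>M {..<p} (\<lambda>_. density lborel std_normal_density))"
    by (simp add: prod_ennreal)
  also have "\<dots> = (\<Prod>k<p. ennreal (exp ((sqrt (2 * s * l k) * coord x k)\<^sup>2 / 2)))"
    by (subst P.product_nn_integral_prod) (auto simp: std_normal_mgf)
  also have "\<dots> = (\<Prod>k<p. ennreal (exp (s * (l k * (coord x k)\<^sup>2))))"
    using s l by (intro prod.cong) (auto simp: power_mult_distrib)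
  also have "\<dots> = ennreal (exp (s * quad_form A x))"
    by (simp add: quad_form_coord[OF x] sum_distrib_left exp_sum prod_ennreal)
  finally show ?thesis .
qed

text \<open>Linearize, exchange the two integrals, and bound the exponential moment of the linear functional.
What is left is the same expression with the eigenvalues squared and with independent standard normal
coordinates, for which the integral factorizes.\<close>

lemma quad_form_mgf_le:
  assumes M: "prob_space M" and X: "vec_mgf_le p A \<kappa> M X" and s: "s \<ge> 0" and \<kappa>: "\<kappa> \<ge> 0"
    and l: "\<And>k. k < p \<Longrightarrow> l k \<ge> 0" and small: "\<And>k. k < p \<Longrightarrow> \<kappa> * s * (l k)\<^sup>2 \<le> 1/4"
  shows "(\<integral>\<^sup>+\<omega>. ennreal (exp (s * quad_form A (X \<omega>))) \<partial>M) \<le> ennreal (exp (2 * \<kappa> * s * (\<Sum>k<p. (l k)\<^sup>2)))"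
proof -
  define G where "G = Pi\<^sub>M {..<p} (\<lambda>_. density lborel std_normal_density)"
  define b where "b z k = sqrt (2 * s * l k) * z k" for z :: "nat \<Rightarrow> real" and k
  interpret std: prob_space "density lborel std_normal_density" by (rule prob_space_normal_density) simp
  interpret P: product_prob_space "\<lambda>_. density lborel std_normal_density" "{..<p}" by standard
  interpret M: prob_space M by (rule M)
  interpret G: prob_space G unfolding G_def by (rule P.prob_space_axioms)
  interpret MG: pair_sigma_finite M G ..
  have Xm: "X \<in> measurable M (borel_vec p)" using X by (simp add: vec_mgf_le_def)
  have Xc: "X \<omega> \<in> carrier_vec p" if "\<omega> \<in> space M" for \<omega> using measurable_space[OF Xm that] by simp
  have zm: "(\<lambda>z. z k) \<in> borel_measurable G" if "k < p" for k
    using measurable_component_singleton[of k "{..<p}" "\<lambda>_. density lborel std_normal_density"] that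
    by (simp add: G_def)
  have "(\<lambda>(\<omega>, z). exp (\<Sum>k<p. b z k * coord (X \<omega>) k)) \<in> borel_measurable (M \<Otimes>\<^sub>M G)"
    unfolding b_def case_prod_beta
    using measurable_compose[OF measurable_snd zm] measurable_compose[OF measurable_fst measurable_coord[OF Xm]]
    by (intro measurable_compose[OF _ borel_measurable_exp] borel_measurable_sum borel_measurable_times) auto
  then have meas: "(\<lambda>(\<omega>, z). ennreal (exp (from_coord (b z) \<bullet> X \<omega>))) \<in> borel_measurable (M \<Otimes>\<^sub>M G)"
    using Xc by (subst measurable_cong[where g="\<lambda>(\<omega>, z). ennreal (exp (\<Sum>k<p. b z k * coord (X \<omega>) k))"])
      (auto simp: space_pair_measure scalar_prod_from_coord case_prod_beta)
  have "(\<integral>\<^sup>+\<omega>. ennreal (exp (s * quad_form A (X \<omega>))) \<partial>M) =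
      (\<integral>\<^sup>+\<omega>. (\<integral>\<^sup>+z. ennreal (exp (from_coord (b z) \<bullet> X \<omega>)) \<partial>G) \<partial>M)"
    unfolding G_def b_def by (intro nn_integral_cong) (simp add: exp_quad_form_linearization Xc s l)
  also have "\<dots> = (\<integral>\<^sup>+z. (\<integral>\<^sup>+\<omega>. ennreal (exp (from_coord (b z) \<bullet> X \<omega>)) \<partial>M) \<partial>G)"
    using MG.Fubini'[OF meas] by simp
  also have "\<dots> \<le> (\<integral>\<^sup>+z. ennreal (exp (\<kappa> * quad_form A (from_coord (b z)) / 2)) \<partial>G)"
    using X by (intro nn_integral_mono) (auto simp: vec_mgf_le_def)
  also have "\<dots> = (\<integral>\<^sup>+z. (\<Prod>k<p. ennreal (exp (\<kappa> * s * (l k)\<^sup>2 * (z k)\<^sup>2))) \<partial>G)"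
  proof (rule nn_integral_cong)
    fix z
    have "\<kappa> * quad_form A (from_coord (b z)) / 2 = (\<Sum>k<p. \<kappa> * (l k * (b z k)\<^sup>2) / 2)"
      by (subst quad_form_coord, simp) (simp add: coord_from_coord sum_distrib_left sum_divide_distrib)
    also have "\<dots> = (\<Sum>k<p. \<kappa> * s * (l k)\<^sup>2 * (z k)\<^sup>2)"
      using l s by (intro sum.cong) (auto simp: b_def power_mult_distrib power2_eq_square)
    finally show "ennreal (exp (\<kappa> * quad_form A (from_coord (b z)) / 2)) =
        (\<Prod>k<p. ennreal (exp (\<kappa> * s * (l k)\<^sup>2 * (z k)\<^sup>2)))"
      by (simp add: exp_sum prod_ennreal)
  qed
  also have "\<dots> = (\<Prod>k<p. \<integral>\<^sup>+x. ennreal (exp (\<kappa> * s * (l k)\<^sup>2 * x\<^sup>2)) \<partial>density lborel std_normal_density)"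
    unfolding G_def by (subst P.product_nn_integral_prod) auto
  also have "\<dots> \<le> (\<Prod>k<p. ennreal (exp (2 * (\<kappa> * s * (l k)\<^sup>2))))"
    using s \<kappa> small by (intro prod_mono_ennreal std_normal_square_mgf_le) auto
  also have "\<dots> = ennreal (exp (2 * \<kappa> * s * (\<Sum>k<p. (l k)\<^sup>2)))"
    by (simp add: sum_distrib_left exp_sum prod_ennreal mult_ac)
  finally show ?thesis .
qed

text \<open>A deviation inequality of Hanson-Wright type for a positive definite form: the mean contributes the
trace, and the fluctuations at level \<open>L\<close> the largest eigenvalue of the square.\<close>

lemma quad_form_tail:
  assumes M: "prob_space M" and X: "vec_mgf_le p A \<kappa> M X" and \<kappa>: "\<kappa> > 0"
    and pd: "pos_def_mat p A" and p: "p > 0"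
  shows "measure M {\<omega> \<in> space M. quad_form A (X \<omega>) \<ge>
      \<kappa> * (2 * mat_trace (A * A) + 4 * (largest_eigenvalue A)\<^sup>2 * L)} \<le> exp (- L)"
proof -
  interpret M: prob_space M by (rule M)
  interpret sq: orthogonal_diagonalization p "A * A" U "\<lambda>k. (l k)\<^sup>2" by (rule square)
  define m where "m = largest_eigenvalue A"
  \<comment> \<open>The largest exponent to which \<open>quad_form_mgf_le\<close> applies.\<close>
  define s where "s = 1 / (4 * \<kappa> * m\<^sup>2)"
  have m: "m > 0" using largest_eigenvalue_pos[OF pd p] by (simp add: m_def)
  have s: "s > 0" using m \<kappa> by (simp add: s_def)
  have small: "\<kappa> * s * (l k)\<^sup>2 \<le> 1/4" if "k < p" for k
  proof -
    have "(l k)\<^sup>2 \<le> m\<^sup>2"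
      using eigenvalue_le_largest[OF that] eigenvalue_pos[OF pd that] by (simp add: m_def power_mono)
    then show ?thesis using m \<kappa> by (simp add: s_def field_simps)
  qed
  have Xm: "X \<in> measurable M (borel_vec p)" using X by (simp add: vec_mgf_le_def)
  let ?t = "\<kappa> * (2 * mat_trace (A * A) + 4 * m\<^sup>2 * L)"
  have "M.prob {\<omega> \<in> space M. s * quad_form A (X \<omega>) \<ge> s * ?t} \<le>
      exp (2 * \<kappa> * s * (\<Sum>k<p. (l k)\<^sup>2) - s * ?t)"
    using borel_measurable_quad_form[OF A_carrier Xm] s \<kappa> eigenvalue_pos[OF pd] small
    by (intro M.chernoff_bound quad_form_mgf_le M X) (auto intro: less_imp_le)
  also have "2 * \<kappa> * s * (\<Sum>k<p. (l k)\<^sup>2) - s * ?t = - L"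
    using m \<kappa> by (simp add: sq.trace s_def field_simps)
  finally show ?thesis using s by (simp add: m_def)
qed

end

text \<open>The vector \<open>0\<close> has to be treated apart, since a functional of variance \<open>0\<close> has no density.\<close>

lemma gaussian_law_mgf:
  assumes N: "gaussian_law p S N" and S: "pos_def_mat p S" and u: "u \<in> carrier_vec p"
  shows "(\<integral>\<^sup>+w. ennreal (exp (u \<bullet> w)) \<partial>N) = ennreal (exp (quad_form S u / 2))"
proof (cases "u = 0\<^sub>v p")
  case True
  interpret prob_space N using N by (simp add: gaussian_law_def)
  have "space N = carrier_vec p"
    using N sets_eq_imp_space_eq[of N "borel_vec p"] by (simp add: gaussian_law_def)
  then have "(\<integral>\<^sup>+w. ennreal (exp (u \<bullet> w)) \<partial>N) = (\<integral>\<^sup>+w. 1 \<partial>N)"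
    by (intro nn_integral_cong) (simp add: True)
  moreover have "quad_form S u = 0"
    using pos_def_mat_carrier[OF S] by (simp add: True quad_form_def)
  ultimately show ?thesis by (simp add: emeasure_space_1)
next
  case False
  let ?\<sigma> = "sqrt (quad_form S u)"
  have q: "quad_form S u > 0" using S u False by (simp add: pos_def_mat_def)
  have "distributed N lborel (\<lambda>w. u \<bullet> w) (normal_density 0 ?\<sigma>)"
    using N u False by (simp add: gaussian_law_def)
  from distributed_nn_integral[OF this, of "\<lambda>x. ennreal (exp x)"]
  have "(\<integral>\<^sup>+w. ennreal (exp (u \<bullet> w)) \<partial>N) = (\<integral>\<^sup>+x. ennreal (normal_density 0 ?\<sigma> x) * ennreal (exp (1 * x)) \<partial>lborel)"
    by simp
  also have "\<dots> = ennreal (exp (quad_form S u / 2))"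
    using q by (subst nn_integral_normal_density_exp) auto
  finally show ?thesis .
qed

lemma vec_mgf_le_fst:
  assumes "sigma_finite_measure T" "prob_space E" and X: "vec_mgf_le p A \<kappa> T X"
  shows "vec_mgf_le p A \<kappa> (T \<Otimes>\<^sub>M E) (\<lambda>\<omega>. X (fst \<omega>))"
proof -
  interpret T: sigma_finite_measure T by fact
  interpret E: prob_space E by fact
  have Xm: "X \<in> measurable T (borel_vec p)" using X by (simp add: vec_mgf_le_def)
  have "(\<integral>\<^sup>+\<omega>. ennreal (exp (a \<bullet> X (fst \<omega>))) \<partial>(T \<Otimes>\<^sub>M E)) \<le> ennreal (exp (\<kappa> * quad_form A a / 2))"
    if a: "a \<in> carrier_vec p" for a
  proof -
    have "(\<integral>\<^sup>+\<omega>. ennreal (exp (a \<bullet> X (fst \<omega>))) \<partial>(T \<Otimes>\<^sub>M E)) = (\<integral>\<^sup>+t. \<integral>\<^sup>+e. ennreal (exp (a \<bullet> X t)) \<partial>E \<partial>T)"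
      using borel_measurable_scalar_prod_const[OF a measurable_compose[OF measurable_fst Xm], of E]
      by (subst E.nn_integral_fst[symmetric]) auto
    then show ?thesis using X a by (simp add: E.emeasure_space_1 vec_mgf_le_def)
  qed
  then show ?thesis using measurable_compose[OF measurable_fst Xm] by (simp add: vec_mgf_le_def)
qed

section \<open>The classification model\<close>

text \<open>The hypotheses of the theorem for a single parameter \<open>\<theta>\<close>; the measures \<open>training\<close> and \<open>fresh\<close> below
are the two independent halves of the model.\<close>

locale gaussian_classification =
  fixes n p :: nat and \<Sigma> :: "real mat" and N :: "real vec measure" and Q :: "real vec pmf"
    and \<theta> :: "real vec"
  assumes n: "n \<ge> 1" and p: "p \<ge> 1" and \<Sigma>: "pos_def_mat p \<Sigma>" and N: "gaussian_law p \<Sigma> N"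
    and labels: "set_pmf Q \<subseteq> label_vectors n" and \<theta>: "\<theta> \<in> carrier_vec p"
begin

abbreviation training :: "(real vec \<times> (nat \<Rightarrow> real vec)) measure" where
  "training \<equiv> measure_pmf Q \<Otimes>\<^sub>M Pi\<^sub>M {..<n} (\<lambda>_. N)"

abbreviation fresh :: "(real \<times> real vec) measure" where
  "fresh \<equiv> measure_pmf (pmf_of_set {-1, 1}) \<Otimes>\<^sub>M N"

sublocale N: prob_space N
  using N by (simp add: gaussian_law_def)

sublocale noise: product_prob_space "\<lambda>_. N" "{..<n}" ..

sublocale noise: prob_space "Pi\<^sub>M {..<n} (\<lambda>_. N)"
  by (rule noise.prob_space_axioms)

sublocale training: pair_prob_space "measure_pmf Q" "Pi\<^sub>M {..<n} (\<lambda>_. N)" ..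

sublocale fresh: pair_prob_space "measure_pmf (pmf_of_set {-1, 1 :: real})" N ..

sublocale all: pair_prob_space training fresh ..

lemma \<Sigma>_carrier: "\<Sigma> \<in> carrier_mat p p"
  using \<Sigma> by (rule pos_def_mat_carrier)

lemma sets_N: "sets N = sets (borel_vec p)"
  using N by (simp add: gaussian_law_def)

lemma space_N: "space N = carrier_vec p"
  using sets_eq_imp_space_eq[OF sets_N] by simp

lemma measurable_from_N: "measurable M N = measurable M (borel_vec p)"
  by (rule measurable_cong_sets) (simp_all add: sets_N)

lemma space_training: "space training = UNIV \<times> ({..<n} \<rightarrow>\<^sub>E carrier_vec p)"
  by (simp add: space_pair_measure space_PiM space_N)

lemma noise_carrier:
  assumes "t \<in> space training" "i < n" shows "snd t i \<in> carrier_vec p"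
proof -
  have "snd t \<in> {..<n} \<rightarrow>\<^sub>E carrier_vec p"
    using assms(1) unfolding space_training by (simp add: mem_Times_iff)
  then show ?thesis using assms(2) by (auto dest: PiE_mem)
qed

lemma space_fresh: "space fresh = UNIV \<times> carrier_vec p"
  by (simp add: space_pair_measure space_N)

text \<open>Multiplication by a label preserves the exponential moments, because the law is symmetric. This is
why neither the training labels nor the new label affect the bounds.\<close>

lemma mgf_signed:
  assumes "a \<in> carrier_vec p" "e \<in> {-1, 1}"
  shows "(\<integral>\<^sup>+w. ennreal (exp (e * (a \<bullet> w))) \<partial>N) = ennreal (exp (quad_form \<Sigma> a / 2))"
proof -
  have "(\<integral>\<^sup>+w. ennreal (exp (e * (a \<bullet> w))) \<partial>N) = (\<integral>\<^sup>+w. ennreal (exp ((e \<cdot>\<^sub>v a) \<bullet> w)) \<partial>N)"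
    using assms by (intro nn_integral_cong) (simp add: space_N)
  also have "\<dots> = ennreal (exp (quad_form \<Sigma> (e \<cdot>\<^sub>v a) / 2))"
    using assms by (intro gaussian_law_mgf[OF N \<Sigma>]) simp
  also have "quad_form \<Sigma> (e \<cdot>\<^sub>v a) = quad_form \<Sigma> a"
    using assms by (auto simp: quad_form_smult[OF \<Sigma>_carrier])
  finally show ?thesis .
qed

fun noise_sum :: "real vec \<times> (nat \<Rightarrow> real vec) \<Rightarrow> real vec" where
  "noise_sum (\<eta>, W) = vec p (\<lambda>j. \<Sum>i<n. \<eta> $ i * W i $ j)"

lemma noise_sum_carrier [simp]: "noise_sum t \<in> carrier_vec p"
  by (cases t) simp

lemma measurable_label: "(\<lambda>t. f (fst t)) \<in> measurable training (count_space UNIV)"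
  by (rule measurable_compose[OF measurable_fst]) simp

lemma measurable_label_index: "(\<lambda>t. fst t $ i) \<in> borel_measurable training"
  by (rule measurable_compose[OF measurable_fst]) simp

lemma measurable_noise: "i < n \<Longrightarrow> (\<lambda>t. snd t i) \<in> measurable training (borel_vec p)"
  using measurable_compose[OF measurable_snd measurable_component_singleton[of i "{..<n}" "\<lambda>_. N"]]
  by (simp add: measurable_from_N)

lemma measurable_noise_sum: "noise_sum \<in> measurable training (borel_vec p)"
proof (rule measurable_borel_vecI)
  fix j assume j: "j < p"
  have "(\<lambda>t. noise_sum t $ j) = (\<lambda>t. \<Sum>i<n. fst t $ i * snd t i $ j)"
    using j by auto
  then show "(\<lambda>t. noise_sum t $ j) \<in> borel_measurable training"
    using measurable_label_index measurable_compose[OF measurable_noise measurable_vec_index[OF j]]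
    by (auto intro!: borel_measurable_sum borel_measurable_times)
qed simp

lemma scalar_prod_noise_sum:
  assumes "a \<in> carrier_vec p" "W \<in> {..<n} \<rightarrow>\<^sub>E carrier_vec p"
  shows "a \<bullet> noise_sum (\<eta>, W) = (\<Sum>i<n. \<eta> $ i * (a \<bullet> W i))"
proof -
  have "a \<bullet> noise_sum (\<eta>, W) = (\<Sum>j<p. \<Sum>i<n. \<eta> $ i * (a $ j * W i $ j))"
    by (simp add: scalar_prod_def atLeast0LessThan sum_distrib_left mult_ac)
  also have "\<dots> = (\<Sum>i<n. \<eta> $ i * (\<Sum>j<p. a $ j * W i $ j))"
    by (subst sum.swap) (simp add: sum_distrib_left)
  also have "\<dots> = (\<Sum>i<n. \<eta> $ i * (a \<bullet> W i))"
  proof (intro sum.cong refl)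
    fix i assume "i \<in> {..<n}"
    then have "W i \<in> carrier_vec p" using assms(2) by auto
    then show "\<eta> $ i * (\<Sum>j<p. a $ j * W i $ j) = \<eta> $ i * (a \<bullet> W i)"
      by (auto simp: scalar_prod_def atLeast0LessThan)
  qed
  finally show ?thesis .
qed

lemma noise_sum_mgf: "vec_mgf_le p \<Sigma> (real n) training noise_sum"
  unfolding vec_mgf_le_def
proof (intro conjI ballI measurable_noise_sum)
  fix a :: "real vec" assume a: "a \<in> carrier_vec p"
  let ?W = "Pi\<^sub>M {..<n} (\<lambda>_. N)"
  have am: "(\<lambda>w. a \<bullet> w) \<in> borel_measurable N"
    using borel_measurable_scalar_prod_const[OF a measurable_ident]
    by (simp add: measurable_cong_sets[OF sets_N refl] id_def)
  have "(\<integral>\<^sup>+t. ennreal (exp (a \<bullet> noise_sum t)) \<partial>training) =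
      (\<integral>\<^sup>+\<eta>. \<integral>\<^sup>+W. ennreal (exp (a \<bullet> noise_sum (\<eta>, W))) \<partial>?W \<partial>measure_pmf Q)"
    using borel_measurable_scalar_prod_const[OF a measurable_noise_sum]
    by (subst noise.nn_integral_fst[symmetric]) auto
  also have "\<dots> = (\<integral>\<^sup>+\<eta>. ennreal (exp (real n * quad_form \<Sigma> a / 2)) \<partial>measure_pmf Q)"
  proof (rule nn_integral_cong_AE, rule AE_pmfI)
    fix \<eta> assume "\<eta> \<in> set_pmf Q"
    then have \<eta>: "\<eta> $ i \<in> {-1, 1}" if "i < n" for i
      using labels that by (auto simp: label_vectors_def)
    have "(\<integral>\<^sup>+W. ennreal (exp (a \<bullet> noise_sum (\<eta>, W))) \<partial>?W) =
        (\<integral>\<^sup>+W. (\<Prod>i<n. ennreal (exp (\<eta> $ i * (a \<bullet> W i)))) \<partial>?W)"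
      by (intro nn_integral_cong)
         (simp add: scalar_prod_noise_sum[OF a] space_PiM space_N exp_sum prod_ennreal del: noise_sum.simps)
    also have "\<dots> = (\<Prod>i<n. \<integral>\<^sup>+w. ennreal (exp (\<eta> $ i * (a \<bullet> w))) \<partial>N)"
      using am by (intro noise.product_nn_integral_prod) auto
    also have "\<dots> = (\<Prod>i<n. ennreal (exp (quad_form \<Sigma> a / 2)))"
      using \<eta> a by (intro prod.cong mgf_signed) auto
    also have "\<dots> = ennreal (exp (real n * quad_form \<Sigma> a / 2))"
      by (simp add: ennreal_power flip: exp_of_nat_mult)
    finally show "(\<integral>\<^sup>+W. ennreal (exp (a \<bullet> noise_sum (\<eta>, W))) \<partial>?W) =
      ennreal (exp (real n * quad_form \<Sigma> a / 2))" .
  qed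
  finally show "(\<integral>\<^sup>+t. ennreal (exp (a \<bullet> noise_sum t)) \<partial>training)
      \<le> ennreal (exp (real n * quad_form \<Sigma> a / 2))" by simp
qed

lemma fresh_noise_mgf: "vec_mgf_le p \<Sigma> 1 fresh (\<lambda>(e, w). e \<cdot>\<^sub>v w)"
  unfolding vec_mgf_le_def
proof (intro conjI ballI)
  have snd_m: "snd \<in> measurable fresh (borel_vec p)"
    using measurable_snd[of "measure_pmf (pmf_of_set {-1, 1 :: real})" N] by (simp add: measurable_from_N)
  show meas: "(\<lambda>(e, w). e \<cdot>\<^sub>v w) \<in> measurable fresh (borel_vec p)"
  proof (rule measurable_borel_vecI)
    fix j assume j: "j < p"
    have "(\<lambda>\<omega>. fst \<omega> * snd \<omega> $ j) \<in> borel_measurable fresh"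
      using measurable_compose[OF snd_m measurable_vec_index[OF j]]
      by (intro borel_measurable_times) (auto intro: measurable_compose[OF measurable_fst])
    then show "(\<lambda>\<omega>. (case \<omega> of (e, w) \<Rightarrow> e \<cdot>\<^sub>v w) $ j) \<in> borel_measurable fresh"
      using j by (subst measurable_cong[where g="\<lambda>\<omega>. fst \<omega> * snd \<omega> $ j"]) (auto simp: space_fresh)
  qed (auto simp: space_fresh)
  fix a :: "real vec" assume a: "a \<in> carrier_vec p"
  have "(\<integral>\<^sup>+\<omega>. ennreal (exp (a \<bullet> (case \<omega> of (e, w) \<Rightarrow> e \<cdot>\<^sub>v w))) \<partial>fresh) =
      (\<integral>\<^sup>+e. \<integral>\<^sup>+w. ennreal (exp (a \<bullet> (e \<cdot>\<^sub>v w))) \<partial>N \<partial>measure_pmf (pmf_of_set {-1, 1}))"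
    using borel_measurable_scalar_prod_const[OF a meas] by (subst N.nn_integral_fst[symmetric]) auto
  also have "\<dots> = (\<integral>\<^sup>+e. ennreal (exp (quad_form \<Sigma> a / 2)) \<partial>measure_pmf (pmf_of_set {-1, 1 :: real}))"
  proof (rule nn_integral_cong_AE, rule AE_pmfI)
    fix e :: real assume e: "e \<in> set_pmf (pmf_of_set {-1, 1})"
    have "(\<integral>\<^sup>+w. ennreal (exp (a \<bullet> (e \<cdot>\<^sub>v w))) \<partial>N) = (\<integral>\<^sup>+w. ennreal (exp (e * (a \<bullet> w))) \<partial>N)"
      using a by (intro nn_integral_cong) (simp add: space_N)
    also have "\<dots> = ennreal (exp (quad_form \<Sigma> a / 2))" using e by (intro mgf_signed a) auto
    finally show "(\<integral>\<^sup>+w. ennreal (exp (a \<bullet> (e \<cdot>\<^sub>v w))) \<partial>N) = ennreal (exp (quad_form \<Sigma> a / 2))" .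
  qed
  finally show "(\<integral>\<^sup>+\<omega>. ennreal (exp (a \<bullet> (case \<omega> of (e, w) \<Rightarrow> e \<cdot>\<^sub>v w))) \<partial>fresh)
      \<le> ennreal (exp (1 * quad_form \<Sigma> a / 2))" by simp
qed

section \<open>The error of a linear classifier\<close>

definition misclassified :: "real vec \<Rightarrow> real \<times> real vec \<Rightarrow> bool" where
  "misclassified v \<omega> \<longleftrightarrow> sgn (v \<bullet> (fst \<omega> \<cdot>\<^sub>v \<theta> + snd \<omega>)) \<noteq> fst \<omega>"

definition error_prob :: "real vec \<Rightarrow> real" where
  "error_prob v = measure fresh {\<omega> \<in> space fresh. misclassified v \<omega>}"

lemma measurable_fresh_label: "fst \<in> borel_measurable fresh"
  by (rule measurable_compose[OF measurable_fst]) simp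

lemma measurable_fresh_observation: "(\<lambda>\<omega>. fst \<omega> \<cdot>\<^sub>v \<theta> + snd \<omega>) \<in> measurable fresh (borel_vec p)"
proof (rule measurable_borel_vecI)
  fix j assume j: "j < p"
  have "snd \<in> measurable fresh (borel_vec p)"
    using measurable_snd[of "measure_pmf (pmf_of_set {-1, 1 :: real})" N] by (simp add: measurable_from_N)
  from measurable_compose[OF this measurable_vec_index[OF j]]
  have "(\<lambda>\<omega>. fst \<omega> * \<theta> $ j + snd \<omega> $ j) \<in> borel_measurable fresh"
    using measurable_fresh_label by (intro borel_measurable_add borel_measurable_times) auto
  then show "(\<lambda>\<omega>. (fst \<omega> \<cdot>\<^sub>v \<theta> + snd \<omega>) $ j) \<in> borel_measurable fresh"
    using j \<theta> by (subst measurable_cong[where g="\<lambda>\<omega>. fst \<omega> * \<theta> $ j + snd \<omega> $ j"]) (auto simp: space_fresh)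
qed (use \<theta> in \<open>auto simp: space_fresh\<close>)

lemma sets_misclassified:
  assumes f: "f \<in> measurable M (borel_vec p)" and g: "g \<in> measurable M fresh"
  shows "{x \<in> space M. misclassified (f x) (g x)} \<in> sets M"
proof -
  have "(\<lambda>x. sgn (f x \<bullet> (fst (g x) \<cdot>\<^sub>v \<theta> + snd (g x)))) \<in> borel_measurable M"
    using borel_measurable_scalar_prod[OF f measurable_compose[OF g measurable_fresh_observation]]
    by measurable
  then show ?thesis
    using measurable_compose[OF g measurable_fresh_label] unfolding misclassified_def
    by (intro borel_measurable_neq) auto
qed

lemma measurable_error_prob: "error_prob \<in> borel_measurable (borel_vec p)"
proof -
  let ?R = "{x \<in> space (borel_vec p \<Otimes>\<^sub>M fresh). misclassified (fst x) (snd x)}"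
  have "?R \<in> sets (borel_vec p \<Otimes>\<^sub>M fresh)" by (rule sets_misclassified) auto
  then have "(\<lambda>v. emeasure fresh (Pair v -` ?R)) \<in> borel_measurable (borel_vec p)"
    by (rule fresh.measurable_emeasure_Pair)
  then have "(\<lambda>v. enn2real (emeasure fresh (Pair v -` ?R))) \<in> borel_measurable (borel_vec p)" by simp
  moreover have "error_prob v = enn2real (emeasure fresh (Pair v -` ?R))" if "v \<in> space (borel_vec p)" for v
    unfolding error_prob_def measure_def
    using that by (intro arg_cong[of _ _ "\<lambda>S. enn2real (emeasure fresh S)"]) (auto simp: space_pair_measure)
  ultimately show ?thesis by (subst measurable_cong) auto
qed

lemma error_prob_nonneg: "error_prob v \<ge> 0" and error_prob_le_1: "error_prob v \<le> 1"
  by (auto simp: error_prob_def)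

text \<open>For a label \<open>e = \<plusminus>1\<close> an error, a tie included, means \<open>v \<bullet> \<theta> + v \<bullet> (e w) \<le> 0\<close>, a lower deviation of
the sub-Gaussian variable \<open>v \<bullet> (e w)\<close> by \<open>v \<bullet> \<theta>\<close>.\<close>

lemma error_prob_le:
  assumes v: "v \<in> carrier_vec p" and pos: "v \<bullet> \<theta> > 0"
  shows "error_prob v \<le> exp (- ((v \<bullet> \<theta>)\<^sup>2 / (2 * quad_form \<Sigma> v)))"
proof -
  have "v \<noteq> 0\<^sub>v p" using pos \<theta> by auto
  then have q: "quad_form \<Sigma> v > 0" using \<Sigma> v by (simp add: pos_def_mat_def)
  have mv: "- v = (-1) \<cdot>\<^sub>v v" using v by auto
  have qm: "quad_form \<Sigma> (- v) = quad_form \<Sigma> v"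
    unfolding mv by (simp add: quad_form_smult[OF \<Sigma>_carrier v])
  let ?B = "{\<omega> \<in> space fresh. - v \<bullet> (case \<omega> of (e, w) \<Rightarrow> e \<cdot>\<^sub>v w) \<ge> v \<bullet> \<theta>}"
  have meas: "?B \<in> sets fresh"
    using borel_measurable_scalar_prod_const[of "- v" p "\<lambda>(e, w). e \<cdot>\<^sub>v w" fresh] v fresh_noise_mgf
    by (auto simp: vec_mgf_le_def)
  have lab: "AE \<omega> in fresh. fst \<omega> \<in> {-1, 1}"
  proof (rule fresh.AE_pair_measure)
    show "{\<omega> \<in> space fresh. fst \<omega> \<in> {-1, 1}} \<in> sets fresh"
      using measurable_sets[OF measurable_fresh_label, of "{-1, 1}"]
      by (simp add: vimage_def Int_def conj_commute)
    show "AE e in measure_pmf (pmf_of_set {-1, 1 :: real}). AE w in N. fst (e, w) \<in> {-1, 1}"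
      by (rule AE_pmfI) simp
  qed
  have "error_prob v \<le> fresh.prob ?B"
    unfolding error_prob_def
  proof (rule fresh.finite_measure_mono_AE[OF _ meas])
    show "AE \<omega> in fresh. \<omega> \<in> {\<omega> \<in> space fresh. misclassified v \<omega>} \<longrightarrow> \<omega> \<in> ?B"
      using lab
    proof eventually_elim
      case (elim \<omega>)
      show ?case
      proof (intro impI)
        assume *: "\<omega> \<in> {\<omega> \<in> space fresh. misclassified v \<omega>}"
        obtain e w where \<omega>: "\<omega> = (e, w)" by force
        have w: "w \<in> carrier_vec p" using * by (simp add: \<omega> space_fresh)
        have "v \<bullet> (e \<cdot>\<^sub>v \<theta> + w) = e * (v \<bullet> \<theta>) + v \<bullet> w"
          using v w \<theta> by (simp add: scalar_prod_add_distrib[of _ p])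
        moreover have "sgn (v \<bullet> (e \<cdot>\<^sub>v \<theta> + w)) \<noteq> e" using * by (simp add: misclassified_def \<omega>)
        ultimately have "e * (v \<bullet> w) \<le> - (v \<bullet> \<theta>)"
          using elim by (auto simp: \<omega> sgn_if split: if_splits)
        then show "\<omega> \<in> ?B" using * v w by (simp add: \<omega>)
      qed
    qed
  qed
  also have "\<dots> \<le> exp (- ((v \<bullet> \<theta>)\<^sup>2 / (2 * (1 * quad_form \<Sigma> (- v)))))"
    using v q qm pos by (intro fresh.linear_tail[OF fresh_noise_mgf \<Sigma>_carrier]) auto
  finally show ?thesis by (simp add: qm)
qed

section \<open>The averaging classifier and its conditional error\<close>

fun weight_vector :: "training_data \<Rightarrow> real vec" where
  "weight_vector (Y, \<eta>) = vec p (\<lambda>j. \<Sum>i<n. Y i $ j * \<eta> $ i)"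

lemma averaging_classifier_weight: "averaging_classifier n p D y = sgn (weight_vector D \<bullet> y)"
  by (cases D) simp

text \<open>The training data as a function of the training half of an outcome alone; factoring them in this way
is what makes Fubini applicable to the conditional expectation.\<close>

definition data :: "real vec \<times> (nat \<Rightarrow> real vec) \<Rightarrow> training_data" where
  "data t = ((\<lambda>i\<in>{..<n}. (fst t $ i) \<cdot>\<^sub>v \<theta> + snd t i), fst t)"

lemma training_data_eq: "training_data n \<theta> \<omega> = data (fst \<omega>)"
  by (cases "(n, \<theta>, \<omega>)" rule: training_data.cases) (simp add: data_def)

lemma measurable_data: "data \<in> measurable training (training_space n p)"
  unfolding data_def training_space_def
proof (intro measurable_Pair measurable_restrict measurable_label[of "\<lambda>x. x"])
  fix i assume i: "i \<in> {..<n}"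
  show "(\<lambda>t. (fst t $ i) \<cdot>\<^sub>v \<theta> + snd t i) \<in> measurable training (borel_vec p)"
  proof (rule measurable_borel_vecI)
    fix j assume j: "j < p"
    have "(\<lambda>t. fst t $ i * \<theta> $ j + snd t i $ j) \<in> borel_measurable training"
      using measurable_label_index measurable_compose[OF measurable_noise measurable_vec_index[OF j]] i
      by (intro borel_measurable_add borel_measurable_times) auto
    moreover have "((fst t $ i) \<cdot>\<^sub>v \<theta> + snd t i) $ j = fst t $ i * \<theta> $ j + snd t i $ j"
      if "t \<in> space training" for t
    proof -
      have "snd t i \<in> carrier_vec p" using noise_carrier[OF that] i by simp
      then show ?thesis using j \<theta> by simp
    qed
    ultimately show "(\<lambda>t. ((fst t $ i) \<cdot>\<^sub>v \<theta> + snd t i) $ j) \<in> borel_measurable training"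
      by (subst measurable_cong[where g="\<lambda>t. fst t $ i * \<theta> $ j + snd t i $ j"])
  qed (use \<theta> i noise_carrier in auto)
qed

lemma measurable_weight: "weight_vector \<in> measurable (training_space n p) (borel_vec p)"
proof (rule measurable_borel_vecI)
  show "weight_vector D \<in> carrier_vec p" for D by (cases D) simp
  fix j assume j: "j < p"
  have "(\<lambda>D. fst D i $ j) \<in> borel_measurable (training_space n p)" if "i < n" for i
    unfolding training_space_def
    using measurable_compose[OF measurable_fst
      measurable_compose[OF measurable_component_singleton[of i "{..<n}"] measurable_vec_index[OF j]]] that by simp
  moreover have "(\<lambda>D. snd D $ i) \<in> borel_measurable (training_space n p)" for i
    unfolding training_space_def by (rule measurable_compose[OF measurable_snd]) simp
  ultimately have "(\<lambda>D. \<Sum>i<n. fst D i $ j * snd D $ i) \<in> borel_measurable (training_space n p)"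
    by (intro borel_measurable_sum borel_measurable_times) auto
  moreover have "weight_vector D $ j = (\<Sum>i<n. fst D i $ j * snd D $ i)" for D
    using j by (cases D) simp
  ultimately show "(\<lambda>D. weight_vector D $ j) \<in> borel_measurable (training_space n p)" by simp
qed

lemma weight_data:
  assumes t: "t \<in> space training" and lab: "fst t \<in> label_vectors n"
  shows "weight_vector (data t) = real n \<cdot>\<^sub>v \<theta> + noise_sum t"
proof (rule eq_vecI)
  obtain \<eta> W where tt: "t = (\<eta>, W)" by force
  fix j assume "j < dim_vec (real n \<cdot>\<^sub>v \<theta> + noise_sum t)"
  then have j: "j < p" by (simp add: tt)
  have W: "W i \<in> carrier_vec p" if "i < n" for i using t that by (auto simp: tt space_training)
  have "weight_vector (data t) $ j = (\<Sum>i<n. \<theta> $ j + \<eta> $ i * W i $ j)"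
  proof -
    have "((\<eta> $ i) \<cdot>\<^sub>v \<theta> + W i) $ j * \<eta> $ i = \<theta> $ j + \<eta> $ i * W i $ j" if "i < n" for i
    proof -
      have "\<eta> $ i = -1 \<or> \<eta> $ i = 1" using lab that by (auto simp: tt label_vectors_def)
      then show ?thesis using j \<theta> W[OF that] by auto
    qed
    then show ?thesis using j by (simp add: tt data_def)
  qed
  then show "weight_vector (data t) $ j = (real n \<cdot>\<^sub>v \<theta> + noise_sum t) $ j"
    using j \<theta> by (simp add: tt sum.distrib)
qed (cases t, simp add: data_def)

definition conditional_error :: "outcome \<Rightarrow> real" where
  "conditional_error \<omega> = error_prob (weight_vector (data (fst \<omega>)))"

lemma model_eq: "model n Q N = training \<Otimes>\<^sub>M fresh"
  by (simp add: model_def)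

lemma measurable_training_data:
  "training_data n \<theta> \<in> measurable (training \<Otimes>\<^sub>M fresh) (training_space n p)"
  using measurable_compose[OF measurable_fst measurable_data]
  by (simp add: training_data_eq[abs_def])

lemma measurable_conditional_error: "conditional_error \<in> borel_measurable (training \<Otimes>\<^sub>M fresh)"
  unfolding conditional_error_def[abs_def]
  by (rule measurable_compose[OF measurable_compose[OF measurable_fst measurable_data]
    measurable_compose[OF measurable_weight measurable_error_prob]])

text \<open>An event of the training algebra is a cylinder over the training half. Over a fixed training
outcome, integrating the error indicator over the fresh half gives the error probability of the
fitted weight vector, which depends measurably on the training data. Hence this function satisfies
the defining property of the conditional expectation.\<close>

lemma generalization_error_eq:
  "AE \<omega> in training \<Otimes>\<^sub>M fresh.
     generalization_error n p Q N \<theta> (averaging_classifier n p) \<omega> = conditional_error \<omega>"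
proof -
  let ?M = "training \<Otimes>\<^sub>M fresh" and ?T = "training_space n p"
  define F where "F = training_algebra n p Q N \<theta>"
  have F: "F = vimage_algebra (space ?M) (training_data n \<theta>) ?T"
    by (simp add: F_def training_algebra_def model_eq)
  have td: "training_data n \<theta> \<in> space ?M \<rightarrow> space ?T"
    using measurable_space[OF measurable_training_data] by (intro funcsetI)
  have sub: "subalgebra ?M F"
    unfolding subalgebra_def F
  proof
    show "sets (vimage_algebra (space ?M) (training_data n \<theta>) ?T) \<subseteq> sets ?M"
      unfolding sets_vimage_algebra2[OF td]
      using measurable_sets[OF measurable_training_data] by auto
  qed simp
  interpret sub: finite_measure_subalgebra ?M F
    by standard (rule sub)
  define E where "E = {\<omega> \<in> space ?M. misclassified (weight_vector (data (fst \<omega>))) (snd \<omega>)}"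
  have Em: "E \<in> sets ?M"
    unfolding E_def
    using measurable_compose[OF measurable_compose[OF measurable_fst measurable_data] measurable_weight]
    by (intro sets_misclassified) auto
  have E_eq: "{\<omega> \<in> space ?M. averaging_classifier n p (training_data n \<theta> \<omega>) (new_observation \<theta> \<omega>) \<noteq> new_label \<omega>} = E"
    by (auto simp: E_def misclassified_def training_data_eq averaging_classifier_weight simp del: training_data.simps)
  have "AE \<omega> in ?M. real_cond_exp ?M F (indicator E) \<omega> = conditional_error \<omega>"
  proof (rule sub.real_cond_exp_charact)
    show int1: "integrable ?M (indicator E :: _ \<Rightarrow> real)" 
      using Em by (intro integrable_real_indicator) (simp_all add: all.emeasure_finite flip: less_top)
    show int2: "integrable ?M conditional_error"
      using measurable_conditional_error error_prob_nonneg error_prob_le_1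
      by (intro all.integrable_const_bound[where B=1]) (auto simp: conditional_error_def)
    show "conditional_error \<in> borel_measurable F"
    proof -
      have "training_data n \<theta> \<in> measurable F ?T"
        unfolding F by (rule measurable_vimage_algebra1[OF td])
      from measurable_compose[OF measurable_compose[OF this measurable_weight] measurable_error_prob]
      show ?thesis by (simp only: training_data_eq conditional_error_def[abs_def])
    qed
    fix A assume "A \<in> sets F"
    then obtain B where B: "B \<in> sets ?T" "A = training_data n \<theta> -` B \<inter> space ?M"
      unfolding F sets_vimage_algebra2[OF td] by auto
    then have Am: "A \<in> sets ?M" using measurable_sets[OF measurable_training_data] by simp
    have A_iff: "\<omega> \<in> A \<longleftrightarrow> data (fst \<omega>) \<in> B" if "\<omega> \<in> space ?M" for \<omega>
      using that by (simp add: B(2) training_data_eq)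
    define f1 f2 :: "outcome \<Rightarrow> real"
      where "f1 \<omega> = indicator A \<omega> * indicator E \<omega>" and "f2 \<omega> = indicator A \<omega> * conditional_error \<omega>" for \<omega>
    have f12: "integrable ?M f1" "integrable ?M f2"
      using integrable_mult_indicator[OF Am int1] integrable_mult_indicator[OF Am int2]
      by (simp_all add: f1_def[abs_def] f2_def[abs_def])
    have "(\<integral>e. f1 (t, e) \<partial>fresh) = (\<integral>e. f2 (t, e) \<partial>fresh)" if t: "t \<in> space training" for t
    proof -
      define b :: real where "b = indicator B (data t)"
      \<comment> \<open>Membership in \<open>A\<close> is constant along the fibre over \<open>t\<close>.\<close>
      have b: "indicator A (t, e) = b" if "e \<in> space fresh" for e
        using A_iff[of "(t, e)"] t that by (simp add: b_def space_pair_measure indicator_def)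
      have "(\<integral>e. f1 (t, e) \<partial>fresh) =
          (\<integral>e. b * indicator {e \<in> space fresh. misclassified (weight_vector (data t)) e} e \<partial>fresh)"
      proof (rule Bochner_Integration.integral_cong[OF refl])
        fix e assume e: "e \<in> space fresh"
        then show "f1 (t, e) = b * indicator {e \<in> space fresh. misclassified (weight_vector (data t)) e} e"
          unfolding f1_def b[OF e] using t by (simp add: E_def space_pair_measure[of training] indicator_def)
      qed
      also have "\<dots> = b * error_prob (weight_vector (data t))"
      proof -
        have "{e \<in> space fresh. misclassified v e} \<inter> space fresh = {e \<in> space fresh. misclassified v e}" for v
          by auto
        then show ?thesis by (simp add: error_prob_def)
      qed
      also have "\<dots> = (\<integral>e. b * error_prob (weight_vector (data t)) \<partial>fresh)" by (simp add: fresh.prob_space)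
      also have "\<dots> = (\<integral>e. f2 (t, e) \<partial>fresh)"
        by (intro Bochner_Integration.integral_cong refl) (simp add: b f2_def conditional_error_def)
      finally show ?thesis .
    qed
    then have "(\<integral>t. \<integral>e. f1 (t, e) \<partial>fresh \<partial>training) = (\<integral>t. \<integral>e. f2 (t, e) \<partial>fresh \<partial>training)"
      by (rule Bochner_Integration.integral_cong[OF refl])
    then have "integral\<^sup>L ?M f1 = integral\<^sup>L ?M f2"
      by (simp only: all.integral_fst'[OF f12(1)] all.integral_fst'[OF f12(2)])
    then show "(LINT \<omega>:A|?M. indicator E \<omega>) = (LINT \<omega>:A|?M. conditional_error \<omega>)"
      by (simp add: set_lebesgue_integral_def f1_def[abs_def] f2_def[abs_def])
  qed
  then show ?thesis
    by (simp add: generalization_error_def model_eq E_eq F_def del: training_data.simps)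
qed

section \<open>Risk bounds\<close>

text \<open>The deterministic part: \<open>v \<bullet> \<theta> \<ge> n \<parallel>\<theta>\<parallel>\<^sup>2 / 2\<close> and \<open>v\<^sup>T \<Sigma> v \<le> 8 n\<^sup>2 V\<close>, where \<open>V\<close> is the bracket in
the conclusion, and \<open>(n \<parallel>\<theta>\<parallel>\<^sup>2 / 2)\<^sup>2 / (16 n\<^sup>2 V) = \<parallel>\<theta>\<parallel>\<^sup>4 / (64 V)\<close>. In the applications \<open>\<tau>\<close> is the trace
of \<open>\<Sigma>\<^sup>2\<close> and \<open>\<rho>\<close> the fluctuation term.\<close>

lemma error_bound_of_good_noise:
  assumes t: "t \<in> space training" and lab: "fst t \<in> label_vectors n" and \<theta>0: "\<theta> \<noteq> 0\<^sub>v p"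
    and lin: "- (\<theta> \<bullet> noise_sum t) < real n * (\<theta> \<bullet> \<theta>) / 2"
    and quad: "quad_form \<Sigma> (noise_sum t) < real n * (2 * \<tau> + 4 * \<rho>)" and \<tau>: "\<tau> \<ge> 0"
  shows "error_prob (weight_vector (data t)) \<le>
    exp (- ((\<theta> \<bullet> \<theta>)\<^sup>2 / (64 * (quad_form \<Sigma> \<theta> + (\<tau> + \<rho>) / real n))))"
proof -
  define v where "v = real n \<cdot>\<^sub>v \<theta> + noise_sum t"
  define s where "s = \<theta> \<bullet> \<theta>"
  define V where "V = quad_form \<Sigma> \<theta> + (\<tau> + \<rho>) / real n"
  have v: "v \<in> carrier_vec p" using \<theta> by (simp add: v_def)
  have s: "s > 0" using self_scalar_prod_pos[OF \<theta> \<theta>0] by (simp add: s_def)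
  have n0: "real n > 0" using n by simp
  have v\<theta>: "v \<bullet> \<theta> = real n * s + \<theta> \<bullet> noise_sum t"
    using \<theta> by (simp add: v_def s_def add_scalar_prod_distrib[of _ p] comm_scalar_prod[of "noise_sum t" p])
  then have ge: "v \<bullet> \<theta> \<ge> real n * s / 2" using lin by (simp add: s_def)
  have pos: "real n * s / 2 > 0" using n0 s by simp
  have "v \<noteq> 0\<^sub>v p" using ge pos \<theta> by auto
  then have qv: "quad_form \<Sigma> v > 0" using \<Sigma> v by (simp add: pos_def_mat_def)
  have "quad_form \<Sigma> v \<le> 2 * ((real n)\<^sup>2 * quad_form \<Sigma> \<theta>) + 2 * quad_form \<Sigma> (noise_sum t)"
    using quad_form_add_le[OF \<Sigma>, of "real n \<cdot>\<^sub>v \<theta>" "noise_sum t"] \<theta>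
    by (simp add: v_def quad_form_smult[OF \<Sigma>_carrier])
  also have "\<dots> \<le> 2 * ((real n)\<^sup>2 * quad_form \<Sigma> \<theta>) + 2 * (real n * (2 * \<tau> + 4 * \<rho>))"
    using quad by simp
  also have "\<dots> \<le> 8 * ((real n)\<^sup>2 * quad_form \<Sigma> \<theta>) + 8 * (real n * (\<tau> + \<rho>))"
    using mult_nonneg_nonneg[of "real n" \<tau>] \<tau> n0 quad_form_nonneg[OF \<Sigma> \<theta>]
      mult_nonneg_nonneg[of "(real n)\<^sup>2" "quad_form \<Sigma> \<theta>"] by (simp add: algebra_simps)
  also have "\<dots> = 8 * (real n)\<^sup>2 * V"
    using n0 by (simp add: V_def field_simps power2_eq_square)
  finally have qV: "quad_form \<Sigma> v \<le> 8 * (real n)\<^sup>2 * V" .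
  then have V: "V > 0" using qv n0 by (smt (verit) mult_nonneg_nonpos zero_le_power2)
  have "s\<^sup>2 / (64 * V) = (real n * s / 2)\<^sup>2 / (2 * (8 * (real n)\<^sup>2 * V))"
    using n0 V by (simp add: field_simps power2_eq_square)
  also have "\<dots> \<le> (v \<bullet> \<theta>)\<^sup>2 / (2 * quad_form \<Sigma> v)"
    using ge pos qv qV by (intro frac_le power_mono) (auto simp: mult_ac)
  finally have le: "s\<^sup>2 / (64 * V) \<le> (v \<bullet> \<theta>)\<^sup>2 / (2 * quad_form \<Sigma> v)" .
  have "error_prob v \<le> exp (- ((v \<bullet> \<theta>)\<^sup>2 / (2 * quad_form \<Sigma> v)))"
    using ge pos by (intro error_prob_le v) linarith
  also have "\<dots> \<le> exp (- (s\<^sup>2 / (64 * V)))" using le by simp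
  finally show ?thesis using weight_data[OF t lab] by (simp add: v_def s_def V_def)
qed

lemma AE_training_label: "AE \<omega> in training \<Otimes>\<^sub>M fresh. fst (fst \<omega>) \<in> label_vectors n"
proof (rule all.AE_pair_measure)
  have "Measurable.pred training (\<lambda>t. fst t \<in> label_vectors n)"
    by (rule measurable_label)
  then show "{\<omega> \<in> space (training \<Otimes>\<^sub>M fresh). fst (fst \<omega>) \<in> label_vectors n} \<in> sets (training \<Otimes>\<^sub>M fresh)"
    using measurable_compose[OF measurable_fst] by (auto simp: pred_def)
  have "AE t in training. fst t \<in> label_vectors n"
  proof (rule training.AE_pair_measure)
    show "{t \<in> space training. fst t \<in> label_vectors n} \<in> sets training"
      using \<open>Measurable.pred training (\<lambda>t. fst t \<in> label_vectors n)\<close> by (simp add: pred_def)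
    show "AE \<eta> in measure_pmf Q. AE W in Pi\<^sub>M {..<n} (\<lambda>_. N). fst (\<eta>, W) \<in> label_vectors n"
      using labels by (intro AE_pmfI) auto
  qed
  then show "AE t in training. AE e in fresh. fst (fst (t, e)) \<in> label_vectors n" by eventually_elim simp
qed

definition signal_to_noise :: "real \<Rightarrow> real" where
  "signal_to_noise L = (\<theta> \<bullet> \<theta>)\<^sup>2 /
     (quad_form \<Sigma> \<theta> + (mat_trace (\<Sigma> * \<Sigma>) + (largest_eigenvalue \<Sigma>)\<^sup>2 * L) / real n)"

lemma mat_trace_square_nonneg: "mat_trace (\<Sigma> * \<Sigma>) \<ge> 0"
proof -
  obtain U l where "orthogonal_diagonalization p \<Sigma> U l"
    using pos_def_diagonalization_exists[OF \<Sigma>] by blast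
  then interpret orthogonal_diagonalization p \<Sigma> U l .
  interpret sq: orthogonal_diagonalization p "\<Sigma> * \<Sigma>" U "\<lambda>k. (l k)\<^sup>2" by (rule square)
  show ?thesis unfolding sq.trace by (simp add: sum_nonneg)
qed

text \<open>The union bound over the two events that the noise sum is too large in the quadratic form, or points
too far against \<open>\<theta>\<close>. Both risk bounds are read off from this tail by a choice of \<open>L\<close>.\<close>

lemma conditional_error_tail:
  assumes \<theta>0: "\<theta> \<noteq> 0\<^sub>v p"
  shows "measure (training \<Otimes>\<^sub>M fresh) {\<omega> \<in> space (training \<Otimes>\<^sub>M fresh).
      \<not> conditional_error \<omega> \<le> exp (- (signal_to_noise L / 64))}
    \<le> exp (- L) + exp (- (real n * (\<theta> \<bullet> \<theta>)\<^sup>2 / (8 * quad_form \<Sigma> \<theta>)))"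
proof -
  let ?M = "training \<Otimes>\<^sub>M fresh"
  let ?\<tau> = "mat_trace (\<Sigma> * \<Sigma>)" and ?\<rho> = "(largest_eigenvalue \<Sigma>)\<^sup>2 * L"
  obtain U l where "orthogonal_diagonalization p \<Sigma> U l"
    using pos_def_diagonalization_exists[OF \<Sigma>] by blast
  then interpret diag: orthogonal_diagonalization p \<Sigma> U l .
  define X where "X \<omega> = noise_sum (fst \<omega>)" for \<omega> :: outcome
  have mgf: "vec_mgf_le p \<Sigma> (real n) ?M X"
    unfolding X_def[abs_def] by (intro vec_mgf_le_fst noise_sum_mgf) unfold_locales
  then have Xm: "X \<in> measurable ?M (borel_vec p)" by (simp add: vec_mgf_le_def)
  define B1 where "B1 = {\<omega> \<in> space ?M. quad_form \<Sigma> (X \<omega>) \<ge> real n * (2 * ?\<tau> + 4 * (largest_eigenvalue \<Sigma>)\<^sup>2 * L)}"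
  define B2 where "B2 = {\<omega> \<in> space ?M. - \<theta> \<bullet> X \<omega> \<ge> real n * (\<theta> \<bullet> \<theta>) / 2}"
  have q: "quad_form \<Sigma> \<theta> > 0" using \<Sigma> \<theta> \<theta>0 by (simp add: pos_def_mat_def)
  have n0: "real n > 0" using n by simp
  have m\<theta>: "- \<theta> = (-1) \<cdot>\<^sub>v \<theta>" using \<theta> by auto
  have qm: "quad_form \<Sigma> (- \<theta>) = quad_form \<Sigma> \<theta>"
    unfolding m\<theta> by (simp add: quad_form_smult[OF \<Sigma>_carrier \<theta>])
  have B1m: "B1 \<in> sets ?M"
    using borel_measurable_quad_form[OF \<Sigma>_carrier Xm] by (simp add: B1_def)
  have B2m: "B2 \<in> sets ?M"
    using borel_measurable_scalar_prod_const[OF _ Xm, of "- \<theta>"] \<theta> by (simp add: B2_def)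
  have B1: "measure ?M B1 \<le> exp (- L)"
    unfolding B1_def using n p by (intro diag.quad_form_tail[OF all.prob_space_axioms mgf _ \<Sigma>]) auto
  have "measure ?M B2 \<le> exp (- ((real n * (\<theta> \<bullet> \<theta>) / 2)\<^sup>2 / (2 * (real n * quad_form \<Sigma> (- \<theta>)))))"
    unfolding B2_def using \<theta> q qm n0 self_scalar_prod_pos[OF \<theta> \<theta>0]
    by (intro all.linear_tail[OF mgf \<Sigma>_carrier]) auto
  also have "(real n * (\<theta> \<bullet> \<theta>) / 2)\<^sup>2 / (2 * (real n * quad_form \<Sigma> (- \<theta>))) =
      real n * (\<theta> \<bullet> \<theta>)\<^sup>2 / (8 * quad_form \<Sigma> \<theta>)"
    using n0 q by (simp add: qm field_simps power2_eq_square)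
  finally have B2: "measure ?M B2 \<le> exp (- (real n * (\<theta> \<bullet> \<theta>)\<^sup>2 / (8 * quad_form \<Sigma> \<theta>)))" .
  have "measure ?M {\<omega> \<in> space ?M. \<not> conditional_error \<omega> \<le> exp (- (signal_to_noise L / 64))} \<le> measure ?M (B1 \<union> B2)"
  proof (rule all.finite_measure_mono_AE)
    show "AE \<omega> in ?M. \<omega> \<in> {\<omega> \<in> space ?M. \<not> conditional_error \<omega> \<le> exp (- (signal_to_noise L / 64))} \<longrightarrow> \<omega> \<in> B1 \<union> B2"
      using AE_training_label
    proof eventually_elim
      case (elim \<omega>)
      show ?case
      proof (intro impI, rule ccontr)
        assume *: "\<omega> \<in> {\<omega> \<in> space ?M. \<not> conditional_error \<omega> \<le> exp (- (signal_to_noise L / 64))}"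
          and "\<omega> \<notin> B1 \<union> B2"
        then have nB: "quad_form \<Sigma> (X \<omega>) < real n * (2 * ?\<tau> + 4 * ?\<rho>)" "- \<theta> \<bullet> X \<omega> < real n * (\<theta> \<bullet> \<theta>) / 2"
          by (auto simp: B1_def B2_def not_le mult.assoc)
        have "- \<theta> \<bullet> X \<omega> = - (\<theta> \<bullet> X \<omega>)"
          using \<theta> by (intro uminus_scalar_prod[symmetric, of _ p]) (simp_all add: X_def)
        with nB(2) have lin: "- (\<theta> \<bullet> X \<omega>) < real n * (\<theta> \<bullet> \<theta>) / 2" by simp
        have t: "fst \<omega> \<in> space training" using * by (auto simp: space_pair_measure[of training])
        have "conditional_error \<omega> \<le> exp (- ((\<theta> \<bullet> \<theta>)\<^sup>2 / (64 * (quad_form \<Sigma> \<theta> + (?\<tau> + ?\<rho>) / real n))))"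
          unfolding conditional_error_def
          using nB(1) lin unfolding X_def
          by (intro error_bound_of_good_noise[OF t elim \<theta>0 _ _ mat_trace_square_nonneg])
        then show False using * by (simp add: signal_to_noise_def mult.commute)
      qed
    qed
  qed (use B1m B2m in auto)
  also have "\<dots> \<le> measure ?M B1 + measure ?M B2" by (rule measure_Un_le[OF B1m B2m])
  finally show ?thesis using B1 B2 by linarith
qed

lemma generalization_error_measurable:
  "generalization_error n p Q N \<theta> (averaging_classifier n p) \<in> borel_measurable (training \<Otimes>\<^sub>M fresh)"
  by (simp add: generalization_error_def model_eq borel_measurable_cond_exp2)

lemma conditional_error_le_1: "conditional_error \<omega> \<le> 1"
  by (simp add: conditional_error_def error_prob_le_1)

text \<open>The exceptional probability from the linear event is controlled by \<open>exp (- n / 128)\<close> only when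
\<open>\<parallel>\<theta>\<parallel>\<^sup>4 / \<theta>\<^sup>T \<Sigma> \<theta>\<close> is bounded below. The factor \<open>3\<close> makes the claim trivial in the other case.\<close>

lemma generalization_error_high_probability:
  assumes \<delta>: "0 < \<delta>" "\<delta> < 1"
  shows "1 - \<delta> - exp (- (1/128) * real n) \<le> measure (model n Q N) {\<omega> \<in> space (model n Q N).
     generalization_error n p Q N \<theta> (averaging_classifier n p) \<omega> \<le> 3 * exp (- (1/128) * signal_to_noise (ln (1 / \<delta>)))}"
proof -
  let ?M = "training \<Otimes>\<^sub>M fresh"
  let ?R = "generalization_error n p Q N \<theta> (averaging_classifier n p)"
  define h where "h = signal_to_noise (ln (1 / \<delta>))"
  let ?b = "3 * exp (- (1/128) * h)"
  have Gm: "{\<omega> \<in> space ?M. ?R \<omega> \<le> ?b} \<in> sets ?M"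
    using generalization_error_measurable by simp
  have "1 - \<delta> - exp (- (1/128) * real n) \<le> measure ?M {\<omega> \<in> space ?M. ?R \<omega> \<le> ?b}"
  \<comment> \<open>For \<open>h \<le> 1/8\<close> the claimed bound exceeds \<open>1\<close>; for \<open>h > 1/8\<close> also \<open>\<parallel>\<theta>\<parallel>\<^sup>4 / \<theta>\<^sup>T \<Sigma> \<theta> > 1/8\<close>, since \<open>h\<close> has the
    larger denominator.\<close>
  proof (cases "h \<le> 1/8")
    case True
    have "1 \<le> 3 * exp (- (1/1024) :: real)" using exp_ge_add_one_self[of "- (1/1024) :: real"] by simp
    also have "\<dots> \<le> ?b" using True by simp
    finally have b1: "1 \<le> ?b" .
    have "AE \<omega> in ?M. ?R \<omega> \<le> ?b"
      using generalization_error_eq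
    proof eventually_elim
      case (elim \<omega>)
      show ?case using elim conditional_error_le_1[of \<omega>] b1 by linarith
    qed
    then have "measure ?M {\<omega> \<in> space ?M. ?R \<omega> \<le> ?b} = 1"
      using all.prob_Collect_eq_1[OF Gm] by simp
    then show ?thesis using \<delta> exp_gt_zero[of "- (1/128) * real n"] by linarith
  next
    case False
    then have \<theta>0: "\<theta> \<noteq> 0\<^sub>v p" by (auto simp: h_def signal_to_noise_def)
    have q: "quad_form \<Sigma> \<theta> > 0" using \<Sigma> \<theta> \<theta>0 by (simp add: pos_def_mat_def)
    have "h \<le> (\<theta> \<bullet> \<theta>)\<^sup>2 / quad_form \<Sigma> \<theta>"
      unfolding h_def signal_to_noise_def using q mat_trace_square_nonneg \<delta>
      by (intro divide_left_mono) (auto intro!: mult_pos_pos add_pos_nonneg divide_nonneg_nonneg add_nonneg_nonneg mult_nonneg_nonneg)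
    then have "1/8 \<le> (\<theta> \<bullet> \<theta>)\<^sup>2 / quad_form \<Sigma> \<theta>" using False by linarith
    from mult_left_mono[OF this, of "real n / 8"]
    have "real n / 64 \<le> real n * (\<theta> \<bullet> \<theta>)\<^sup>2 / (8 * quad_form \<Sigma> \<theta>)" by (simp add: field_simps)
    then have e: "exp (- (real n * (\<theta> \<bullet> \<theta>)\<^sup>2 / (8 * quad_form \<Sigma> \<theta>))) \<le> exp (- (1/128) * real n)" by simp
    let ?bad = "{\<omega> \<in> space ?M. \<not> conditional_error \<omega> \<le> exp (- (h / 64))}"
    have bm: "?bad \<in> sets ?M" using measurable_conditional_error by simp
    have tail: "measure ?M ?bad \<le> exp (- ln (1 / \<delta>)) + exp (- (real n * (\<theta> \<bullet> \<theta>)\<^sup>2 / (8 * quad_form \<Sigma> \<theta>)))"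
      unfolding h_def by (rule conditional_error_tail[OF \<theta>0])
    have bad: "measure ?M ?bad \<le> \<delta> + exp (- (1/128) * real n)"
    proof -
      have "exp (- ln (1 / \<delta>)) = \<delta>" using \<delta> by (simp add: ln_div)
      from order_trans[OF tail[unfolded this] add_left_mono[OF e]] show ?thesis .
    qed
    have "1 - measure ?M ?bad = measure ?M (space ?M - ?bad)" using all.prob_compl[OF bm] by simp
    also have "\<dots> \<le> measure ?M {\<omega> \<in> space ?M. ?R \<omega> \<le> ?b}"
    proof (rule all.finite_measure_mono_AE[OF _ Gm])
      have le: "exp (- (h / 64)) \<le> ?b"
      proof -
        have "exp (- (h / 64)) \<le> exp (- (1/128) * h)" using False by simp
        then show ?thesis using exp_gt_zero[of "- (1/128) * h"] by linarith
      qed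
      show "AE \<omega> in ?M. \<omega> \<in> space ?M - ?bad \<longrightarrow> \<omega> \<in> {\<omega> \<in> space ?M. ?R \<omega> \<le> ?b}"
        using generalization_error_eq
      proof eventually_elim
        case (elim \<omega>)
        show ?case
        proof
          assume "\<omega> \<in> space ?M - ?bad"
          then have "\<omega> \<in> space ?M" "conditional_error \<omega> \<le> exp (- (h / 64))" by blast+
          moreover from this(2) le have "?R \<omega> \<le> ?b" unfolding elim by (rule order_trans)
          ultimately show "\<omega> \<in> {\<omega> \<in> space ?M. ?R \<omega> \<le> ?b}" by blast
        qed
      qed
    qed
    finally show ?thesis using bad by simp
  qed
  then show ?thesis unfolding model_eq h_def .
qed

text \<open>With \<open>d = \<parallel>\<theta>\<parallel>\<^sup>2 / \<parallel>\<Sigma>\<parallel>\<close> take the deviation level \<open>L = d\<close>. As \<open>n \<ge> 1\<close>, this level enlarges the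
denominator by at most \<open>d \<parallel>\<Sigma>\<parallel>\<^sup>2\<close>, which is also the bound for \<open>\<theta>\<^sup>T \<Sigma> \<theta>\<close>, and both exceptional
probabilities are at most \<open>exp (- d / 8)\<close>, which is below the claimed bound. Finally \<open>x\<^sup>2 / (x + a)\<close> increases in \<open>x\<close>, so that \<open>d\<close>
may be replaced by its lower bound \<open>\<Delta>\<^sup>2\<close>.\<close>

lemma expected_generalization_error:
  assumes \<Delta>: "\<Delta> > 0" and large: "\<theta> \<bullet> \<theta> \<ge> \<Delta>\<^sup>2 * largest_eigenvalue \<Sigma>"
  shows "integral\<^sup>L (model n Q N) (generalization_error n p Q N \<theta> (averaging_classifier n p)) \<le>
    3 * exp (- (1/128) * (\<Delta> ^ 4 / (\<Delta>\<^sup>2 + effective_rank (\<Sigma> * \<Sigma>) / real n)))"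
proof -
  let ?M = "training \<Otimes>\<^sub>M fresh"
  obtain U l where "orthogonal_diagonalization p \<Sigma> U l"
    using pos_def_diagonalization_exists[OF \<Sigma>] by blast
  then interpret diag: orthogonal_diagonalization p \<Sigma> U l .
  define m where "m = largest_eigenvalue \<Sigma>"
  define d where "d = (\<theta> \<bullet> \<theta>) / m"
  define a where "a = effective_rank (\<Sigma> * \<Sigma>) / real n"
  define h where "h = \<Delta> ^ 4 / (\<Delta>\<^sup>2 + a)"
  have n0: "real n \<ge> 1" using n by simp
  have m: "m > 0" using diag.largest_eigenvalue_pos[OF \<Sigma>] p by (simp add: m_def)
  have "\<theta> \<bullet> \<theta> > 0" using large m \<Delta> by (auto simp: m_def intro: less_le_trans[rotated])
  then have \<theta>0: "\<theta> \<noteq> 0\<^sub>v p" by auto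
  have d: "\<Delta>\<^sup>2 \<le> d" "d > 0" using large m \<open>\<theta> \<bullet> \<theta> > 0\<close> by (auto simp: d_def field_simps m_def)
  have \<theta>d: "\<theta> \<bullet> \<theta> = m * d" using m by (simp add: d_def)
  have a: "a \<ge> 0" "mat_trace (\<Sigma> * \<Sigma>) = m\<^sup>2 * (a * real n)"
    using mat_trace_square_nonneg n0 m p diag.largest_eigenvalue_square[OF \<Sigma>]
    by (auto simp: a_def effective_rank_def m_def)
  have q: "quad_form \<Sigma> \<theta> > 0" using \<Sigma> \<theta> \<theta>0 by (simp add: pos_def_mat_def)
  have qm: "quad_form \<Sigma> \<theta> \<le> m\<^sup>2 * d"
    using diag.quad_form_le_largest_eigenvalue[OF \<theta>] by (simp add: \<theta>d m_def power2_eq_square mult_ac)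
  have hd: "h \<le> d\<^sup>2 / (d + a)"
  proof -
    have "\<Delta>\<^sup>2 * \<Delta>\<^sup>2 \<le> d * d" using d by (intro mult_mono) auto
    then have "a * (\<Delta>\<^sup>2 * \<Delta>\<^sup>2) \<le> a * (d * d)" using a(1) by (rule mult_left_mono)
    moreover have "\<Delta>\<^sup>2 * d * \<Delta>\<^sup>2 \<le> \<Delta>\<^sup>2 * d * d" using d by (intro mult_left_mono) auto
    ultimately have "\<Delta> ^ 4 * (d + a) \<le> d\<^sup>2 * (\<Delta>\<^sup>2 + a)"
      by (simp add: algebra_simps power2_eq_square power4_eq_xxxx)
    then show ?thesis using d a \<Delta> by (simp add: h_def divide_simps add_pos_nonneg)
  qed
  also have "\<dots> \<le> d" using d a by (simp add: field_simps power2_eq_square)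
  finally have h_d: "h \<le> d" .
  have h0: "h \<ge> 0" using a by (simp add: h_def)
  have "d\<^sup>2 / (2 * (d + a)) \<le> signal_to_noise d"
  proof -
    have "d / real n \<le> d" using n0 d by (simp add: field_simps)
    then have "m\<^sup>2 * (d / real n) \<le> m\<^sup>2 * d" by (intro mult_left_mono) auto
    moreover have "m\<^sup>2 * a \<ge> 0" using a by simp
    ultimately have den: "quad_form \<Sigma> \<theta> + (mat_trace (\<Sigma> * \<Sigma>) + m\<^sup>2 * d) / real n \<le> m\<^sup>2 * (2 * (d + a))"
      using qm n0 unfolding a(2) by (simp add: add_divide_distrib algebra_simps)
    have "d\<^sup>2 / (2 * (d + a)) = (m * d)\<^sup>2 / (m\<^sup>2 * (2 * (d + a)))"
      using m by (simp add: power_mult_distrib)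
    also have "\<dots> \<le> (m * d)\<^sup>2 / (quad_form \<Sigma> \<theta> + (mat_trace (\<Sigma> * \<Sigma>) + m\<^sup>2 * d) / real n)"
    proof (rule divide_left_mono[OF den])
      have "0 < quad_form \<Sigma> \<theta> + (mat_trace (\<Sigma> * \<Sigma>) + m\<^sup>2 * d) / real n"
        using q d mat_trace_square_nonneg by (intro add_pos_nonneg divide_nonneg_nonneg add_nonneg_nonneg) auto
      then show "0 < m\<^sup>2 * (2 * (d + a)) * (quad_form \<Sigma> \<theta> + (mat_trace (\<Sigma> * \<Sigma>) + m\<^sup>2 * d) / real n)"
        using m d a(1) by (intro mult_pos_pos[of "m\<^sup>2 * (2 * (d + a))"]) (auto intro!: mult_pos_pos)
    qed simp
    finally show ?thesis by (simp add: signal_to_noise_def \<theta>d m_def)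
  qed
  moreover have "h / 2 \<le> d\<^sup>2 / (2 * (d + a))" using divide_right_mono[OF hd, of 2] by (simp add: mult.commute)
  ultimately have snb: "h / 2 \<le> signal_to_noise d" by (rule order_trans[rotated])
  let ?bad = "{\<omega> \<in> space ?M. \<not> conditional_error \<omega> \<le> exp (- (signal_to_noise d / 64))}"
  have bm: "?bad \<in> sets ?M" using measurable_conditional_error by simp
  have "d \<le> (\<theta> \<bullet> \<theta>)\<^sup>2 / quad_form \<Sigma> \<theta>"
  proof -
    have "d * quad_form \<Sigma> \<theta> \<le> d * (m\<^sup>2 * d)" using qm d by (intro mult_left_mono) auto
    then show ?thesis using q by (simp add: \<theta>d field_simps power2_eq_square)
  qed
  then have "1 * d \<le> real n * ((\<theta> \<bullet> \<theta>)\<^sup>2 / quad_form \<Sigma> \<theta>)" using n0 d by (intro mult_mono) auto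
  then have lin: "d / 8 \<le> real n * (\<theta> \<bullet> \<theta>)\<^sup>2 / (8 * quad_form \<Sigma> \<theta>)" using q by (simp add: field_simps)
  have "measure ?M ?bad \<le> exp (- d) + exp (- (real n * (\<theta> \<bullet> \<theta>)\<^sup>2 / (8 * quad_form \<Sigma> \<theta>)))"
    by (rule conditional_error_tail[OF \<theta>0])
  also have "\<dots> \<le> exp (- (1/128) * h) + exp (- (1/128) * h)"
    using lin h_d h0 by (intro add_mono) auto
  finally have bad: "measure ?M ?bad \<le> 2 * exp (- (1/128) * h)" by simp
  have int: "integrable ?M conditional_error"
    using measurable_conditional_error error_prob_nonneg error_prob_le_1
    by (intro all.integrable_const_bound[where B=1]) (auto simp: conditional_error_def)
  have ind: "integrable ?M (indicator ?bad :: _ \<Rightarrow> real)"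
    using bm by (intro integrable_real_indicator) (simp_all add: all.emeasure_finite flip: less_top)
  have "integral\<^sup>L ?M (generalization_error n p Q N \<theta> (averaging_classifier n p)) = integral\<^sup>L ?M conditional_error"
    by (intro integral_cong_AE generalization_error_measurable measurable_conditional_error generalization_error_eq)
  also have "\<dots> \<le> (\<integral>\<omega>. exp (- (1/128) * h) + indicator ?bad \<omega> \<partial>?M)"
  proof (rule integral_mono[OF int])
    show "integrable ?M (\<lambda>\<omega>. exp (- (1/128) * h) + indicator ?bad \<omega>)" using ind by simp
    fix \<omega> assume \<omega>: "\<omega> \<in> space ?M"
    show "conditional_error \<omega> \<le> exp (- (1/128) * h) + indicator ?bad \<omega>"
    proof (cases "\<omega> \<in> ?bad")
      case True
      then show ?thesis using conditional_error_le_1[of \<omega>] exp_ge_zero[of "- (1/128) * h"]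
        by (simp add: add_increasing)
    next
      case False
      then have "conditional_error \<omega> \<le> exp (- (signal_to_noise d / 64))" using \<omega> by simp
      also have "\<dots> \<le> exp (- (1/128) * h)" using snb by simp
      finally show ?thesis using False by simp
    qed
  qed
  also have "\<dots> = exp (- (1/128) * h) + measure ?M ?bad"
    using ind bm sets.Int_space_eq2[OF bm] by (simp add: all.prob_space)
  also have "\<dots> \<le> 3 * exp (- (1/128) * h)" using bad by simp
  finally show ?thesis by (simp add: model_eq h_def a_def)
qed

end

theorem theorem2p2:
  shows "\<exists>c C :: real. c > 0 \<and> C > 0 \<and>
    (\<forall>(n :: nat) (p :: nat) (\<Sigma> :: real mat) (N :: real vec measure) (Q :: real vec pmf).
      n \<ge> 1 \<longrightarrow> p \<ge> 1 \<longrightarrow> pos_def_mat p \<Sigma> \<longrightarrow> gaussian_law p \<Sigma> N \<longrightarrow>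
      set_pmf Q \<subseteq> label_vectors n \<longrightarrow>
      (\<forall>\<theta> \<in> carrier_vec p. \<forall>\<delta> :: real. 0 < \<delta> \<longrightarrow> \<delta> < 1 \<longrightarrow>
        measure (model n Q N) {\<omega> \<in> space (model n Q N).
          generalization_error n p Q N \<theta> (averaging_classifier n p) \<omega>
            \<le> C * exp (- c * (eucl_norm \<theta> ^ 4 /
                (quad_form \<Sigma> \<theta> +
                 (mat_trace (\<Sigma> * \<Sigma>) + (largest_eigenvalue \<Sigma>)\<^sup>2 * ln (1 / \<delta>)) / real n)))}
          \<ge> 1 - \<delta> - exp (- c * real n)) \<and>
      (\<forall>\<Delta> :: real. \<Delta> > 0 \<longrightarrow>
        (SUP \<theta> \<in> {\<theta> \<in> carrier_vec p. (eucl_norm \<theta>)\<^sup>2 \<ge> \<Delta>\<^sup>2 * largest_eigenvalue \<Sigma>}.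
          integral\<^sup>L (model n Q N) (generalization_error n p Q N \<theta> (averaging_classifier n p)))
        \<le> C * exp (- c * (\<Delta> ^ 4 / (\<Delta>\<^sup>2 + effective_rank (\<Sigma> * \<Sigma>) / real n)))))"
proof -
  have norm2: "(eucl_norm v)\<^sup>2 = v \<bullet> v" for v
    using conjugate_square_ge_0_vec[of v] by (simp add: eucl_norm_def real_sqrt_pow2_iff)
  then have norm4: "eucl_norm v ^ 4 = (v \<bullet> v)\<^sup>2" for v
    by (metis power2_eq_square power4_eq_xxxx mult.assoc)
  show ?thesis
  proof (rule exI[of _ "1/128"], rule exI[of _ 3], intro conjI allI impI ballI)
    fix n p :: nat and \<Sigma> :: "real mat" and N :: "real vec measure" and Q :: "real vec pmf"
    assume A: "n \<ge> 1" "p \<ge> 1" "pos_def_mat p \<Sigma>" "gaussian_law p \<Sigma> N" "set_pmf Q \<subseteq> label_vectors n"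
    have loc: "gaussian_classification n p \<Sigma> N Q \<theta>" if "\<theta> \<in> carrier_vec p" for \<theta>
      using A that by unfold_locales
    {
      fix \<theta> :: "real vec" and \<delta> :: real
      assume "\<theta> \<in> carrier_vec p" and \<delta>: "0 < \<delta>" "\<delta> < 1"
      then interpret gaussian_classification n p \<Sigma> N Q \<theta> by (intro loc)
      show "measure (model n Q N) {\<omega> \<in> space (model n Q N).
          generalization_error n p Q N \<theta> (averaging_classifier n p) \<omega>
            \<le> 3 * exp (- (1/128) * (eucl_norm \<theta> ^ 4 /
                (quad_form \<Sigma> \<theta> +
                 (mat_trace (\<Sigma> * \<Sigma>) + (largest_eigenvalue \<Sigma>)\<^sup>2 * ln (1 / \<delta>)) / real n)))}
          \<ge> 1 - \<delta> - exp (- (1/128) * real n)"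
        using generalization_error_high_probability[OF \<delta>] unfolding norm4 signal_to_noise_def .
    next
      fix \<Delta> :: real assume \<Delta>: "\<Delta> > 0"
      let ?S = "{\<theta> \<in> carrier_vec p. (eucl_norm \<theta>)\<^sup>2 \<ge> \<Delta>\<^sup>2 * largest_eigenvalue \<Sigma>}"
      show "(SUP \<theta> \<in> ?S. integral\<^sup>L (model n Q N) (generalization_error n p Q N \<theta> (averaging_classifier n p)))
        \<le> 3 * exp (- (1/128) * (\<Delta> ^ 4 / (\<Delta>\<^sup>2 + effective_rank (\<Sigma> * \<Sigma>) / real n)))"
      proof (rule cSUP_least)
        \<comment> \<open>A supremum of reals is bounded through its members only if there are any; a long multiple of a
          unit vector is one.\<close>
        let ?c = "sqrt (max 0 (\<Delta>\<^sup>2 * largest_eigenvalue \<Sigma>))"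
        have "(?c \<cdot>\<^sub>v unit_vec p 0) \<bullet> (?c \<cdot>\<^sub>v unit_vec p 0) = max 0 (\<Delta>\<^sup>2 * largest_eigenvalue \<Sigma>)"
          using A(2) by simp
        then have "?c \<cdot>\<^sub>v unit_vec p 0 \<in> ?S" by (simp add: norm2)
        then show "?S \<noteq> {}" by blast
        fix \<theta> assume "\<theta> \<in> ?S"
        then interpret gaussian_classification n p \<Sigma> N Q \<theta> by (intro loc) simp
        show "integral\<^sup>L (model n Q N) (generalization_error n p Q N \<theta> (averaging_classifier n p))
          \<le> 3 * exp (- (1/128) * (\<Delta> ^ 4 / (\<Delta>\<^sup>2 + effective_rank (\<Sigma> * \<Sigma>) / real n)))"
          using \<open>\<theta> \<in> ?S\<close> by (intro expected_generalization_error[OF \<Delta>]) (simp add: norm2)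
      qed
    }
  qed simp_all
qed

end
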